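(* Let $\mathcal{T}$ be a class of simply generated trees given by a non-periodic weight series $\phi(t)=\sum_{j\ge 0}\phi_j t^j$, with generating function $T(z)=z\phi(T(z))$, and let $\rho$ be the dominant singularity of $T(z)$. For $k\ge 0$ let $T_k(z)$ be the (weighted) generating function of those trees of $\mathcal{T}$ whose protection number is at least $k$, i.e. $T_0(z)=T(z)$ and $T_k(z)=z\left(\phi(T_{k-1}(z))-\phi_0\right)$ for $k\ge 1$. Let $X_n$ be the protection number of a random simply generated tree of size $n$ from $\mathcal{T}$. Then $$\lim_{n\to\infty}\mathbb{E}X_n=\sum_{k\ge 1}\rho^{k-1}\prod_{i=1}^{k-1}\phi'(T_i(\rho))$$ and $$\lim_{n\to\infty}\mathbb{V}X_n=\sum_{k\ge 1}(2k-1)\rho^{k-1}\prod_{i=1}^{k-1}\phi'(T_i(\rho))-\left(\lim_{n\to\infty}\mathbb{E}X_n\right)^2 .$$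
   Context: The protection number of a rooted tree is the length (number of edges) of the shortest path from the root to a leaf; a single vertex is a leaf and has protection number $0$. Simply generated trees: let $\phi(t)=\sum_{j\ge 0}\phi_jt^j$ be a power series with non-negative coefficients, $\phi_0>0$, and $\phi_j>0$ for some $j\ge 2$. Assume that the equation $\tau\phi'(\tau)=\phi(\tau)$ has a unique positive solution $\tau$ (in the open interval of convergence of $\phi$, so that $\phi$ is analytic at $\tau$). The weight of a finite plane rooted tree is $\prod_v \phi_{d(v)}$, the product over all its vertices $v$, with $d(v)$ the number of children of $v$. The size of a tree is its number of vertices. If $t_n$ is the sum of the weights of all plane rooted trees with $n$ vertices, then $T(z)=\sum_{n\ge 0}t_nz^n$ satisfies $T(z)=z\phi(T(z))$. A random simply generated tree of size $n$ is a plane rooted tree with $n$ vertices chosen with probability proportional to its weight (for $n$ with $t_n>0$). Non-periodic means: there are integers $i,j,k$ such that $\phi_i,\phi_j,\phi_k$ are all positive and $\gcd(j-i,k-i)=1$. The dominant singularity $\rho$ of $T(z)$ is its singularity at $z=\rho$, where $\rho>0$ is the radius of convergence; it is determined by $T(\rho)=\rho\phi(T(\rho))$ and $1=\rho\phi'(T(\rho))$. An empty product equals $1$. $\mathbb{E}$ and $\mathbb{V}$ denote expectation and variance. *)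

theory Defs
  imports "HOL-Analysis.FPS_Convergence" "HOL-Probability.Probability_Mass_Function"
begin

section \<open>Plane rooted trees\<close>

datatype ptree = Node "ptree list"

primrec nodes :: "ptree \<Rightarrow> nat" where
  "nodes (Node ts) = 1 + sum_list (map nodes ts)"

text \<open>\<open>leaf_dist t d\<close>: some path from the root of \<open>t\<close> down to a leaf has exactly \<open>d\<close> edges.\<close>

inductive leaf_dist :: "ptree \<Rightarrow> nat \<Rightarrow> bool" where
  leaf: "leaf_dist (Node []) 0"
| child: "t \<in> set ts \<Longrightarrow> leaf_dist t d \<Longrightarrow> leaf_dist (Node ts) (Suc d)"

definition protection :: "ptree \<Rightarrow> nat" where
  "protection t = (LEAST d. leaf_dist t d)"


section \<open>Simply generated trees\<close>

primrec weight :: "real fps \<Rightarrow> ptree \<Rightarrow> real" where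
  "weight \<phi> (Node ts) = fps_nth \<phi> (length ts) * prod_list (map (weight \<phi>) ts)"

definition tree_gf :: "real fps \<Rightarrow> real fps" where
  "tree_gf \<phi> = Abs_fps (\<lambda>n. \<Sum>t | nodes t = n. weight \<phi> t)"

definition prot_gf :: "real fps \<Rightarrow> nat \<Rightarrow> real fps" where
  "prot_gf \<phi> k = Abs_fps (\<lambda>n. \<Sum>t | nodes t = n \<and> k \<le> protection t. weight \<phi> t)"

text \<open>
  The coefficients of the generating function are non-negative, so (Pringsheim) the
  singularity of least modulus on the positive axis is located at the radius of convergence.
  The conversion to a real number is harmless: the radius is finite and positive for every
  weight series as in the theorem.
\<close>

definition dominant_singularity :: "real fps \<Rightarrow> real" where
  "dominant_singularity \<phi> = real_of_ereal (fps_conv_radius (tree_gf \<phi>))"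

text \<open>
  Meaningful only for \<open>n\<close> with positive total weight, see \<open>pmf_random_tree\<close> below; for a
  non-periodic weight series with \<open>fps_nth \<phi> 0 > 0\<close> these are all sufficiently large \<open>n\<close>.
\<close>

definition random_tree :: "real fps \<Rightarrow> nat \<Rightarrow> ptree pmf" where
  "random_tree \<phi> n =
     embed_pmf (\<lambda>t. if nodes t = n then weight \<phi> t / fps_nth (tree_gf \<phi>) n else 0)"

definition nonperiodic :: "real fps \<Rightarrow> bool" where
  "nonperiodic \<phi> \<longleftrightarrow>
     (\<exists>i j k. fps_nth \<phi> i > 0 \<and> fps_nth \<phi> j > 0 \<and> fps_nth \<phi> k > 0 \<and>
              gcd (int j - int i) (int k - int i) = 1)"


section \<open>Consistency of the definitions\<close>

lemma nodes_pos: "0 < nodes t"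
  by (cases t) simp

lemma length_le_sum_nodes: "length ts \<le> sum_list (map nodes ts)"
proof (induction ts)
  case (Cons t ts)
  then show ?case using nodes_pos[of t] by simp
qed simp

lemma finite_nodes_le: "finite {t. nodes t \<le> n}"
proof (induction n)
  case 0
  have "{t. nodes t \<le> 0} = {}"
    using nodes_pos by (metis (mono_tags, lifting) Collect_empty_eq not_le)
  then show ?case by (metis finite.emptyI)
next
  case (Suc n)
  have "{t. nodes t \<le> Suc n} \<subseteq> Node ` {ts. set ts \<subseteq> {t. nodes t \<le> n} \<and> length ts \<le> n}"
  proof
    fix t assume t: "t \<in> {t. nodes t \<le> Suc n}"
    obtain ts where ts: "t = Node ts" by (cases t)
    have s: "sum_list (map nodes ts) \<le> n" using t ts by simp
    have "nodes u \<le> n" if "u \<in> set ts" for u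
      using member_le_sum_list[of "nodes u" "map nodes ts"] that s by simp
    moreover have "length ts \<le> n"
      using length_le_sum_nodes[of ts] s by simp
    ultimately show "t \<in> Node ` {ts. set ts \<subseteq> {t. nodes t \<le> n} \<and> length ts \<le> n}"
      using ts by auto
  qed
  then show ?case
    using finite_lists_length_le[OF Suc] by (meson finite_imageI finite_subset)
qed

lemma finite_nodes_eq: "finite {t. nodes t = n}"
  by (rule finite_subset[OF _ finite_nodes_le[of n]]) auto

lemma weight_nonneg:
  assumes "\<And>j. fps_nth \<phi> j \<ge> 0"
  shows "weight \<phi> t \<ge> 0"
proof (induction t)
  case (Node ts)
  then have "prod_list (map (weight \<phi>) ts) \<ge> 0"
    by (induction ts) auto
  then show ?case using assms by simp
qed

lemma pmf_random_tree:
  assumes nonneg: "\<And>j. fps_nth \<phi> j \<ge> 0" and pos: "fps_nth (tree_gf \<phi>) n > 0"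
  shows "pmf (random_tree \<phi> n) t =
    (if nodes t = n then weight \<phi> t / fps_nth (tree_gf \<phi>) n else 0)"
proof -
  let ?f = "\<lambda>t. if nodes t = n then weight \<phi> t / fps_nth (tree_gf \<phi>) n else 0"
  have f0: "?f t \<ge> 0" for t
    using weight_nonneg[OF nonneg] pos by simp
  have "(\<integral>\<^sup>+ t. ennreal (?f t) \<partial>count_space UNIV) = (\<Sum>t | nodes t = n. ennreal (?f t))"
    by (subst nn_integral_count_space'[OF finite_nodes_eq[of n]]) auto
  also have "\<dots> = ennreal (\<Sum>t | nodes t = n. ?f t)"
    by (intro sum_ennreal f0)
  also have "(\<Sum>t | nodes t = n. ?f t) = (\<Sum>t | nodes t = n. weight \<phi> t) / fps_nth (tree_gf \<phi>) n"
    by (simp add: sum_divide_distrib)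
  also have "\<dots> = 1" using pos by (simp add: tree_gf_def)
  finally show ?thesis
    unfolding random_tree_def using f0 by (subst pmf_embed_pmf) simp_all
qed

lemma leaf_dist_exists: "\<exists>d. leaf_dist t d"
proof (induction t)
  case (Node ts)
  show ?case
  proof (cases ts)
    case Nil
    then show ?thesis using leaf_dist.leaf by blast
  next
    case (Cons u us)
    then have "u \<in> set ts" by simp
    with Node show ?thesis using leaf_dist.child by blast
  qed
qed

lemma le_protection_iff: "k \<le> protection t \<longleftrightarrow> (\<forall>d. leaf_dist t d \<longrightarrow> k \<le> d)"
  unfolding protection_def
  by (meson LeastI_ex Least_le leaf_dist_exists order_trans)

lemma Suc_le_protection_iff:
  "Suc k \<le> protection (Node ts) \<longleftrightarrow> ts \<noteq> [] \<and> (\<forall>t\<in>set ts. k \<le> protection t)"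
proof -
  have "leaf_dist (Node ts) d \<longleftrightarrow>
      ts = [] \<and> d = 0 \<or> (\<exists>t\<in>set ts. \<exists>e. d = Suc e \<and> leaf_dist t e)" for d
    by (subst leaf_dist.simps) auto
  then show ?thesis
    by (auto simp: le_protection_iff)
qed

lemma prot_gf_0: "prot_gf \<phi> 0 = tree_gf \<phi>"
  by (simp add: prot_gf_def tree_gf_def)

lemma finite_forests:
  "finite {ts. length ts = m \<and> sum_list (map nodes ts) = n \<and> (\<forall>t\<in>set ts. P t)}"
proof (rule finite_subset)
  show "{ts. length ts = m \<and> sum_list (map nodes ts) = n \<and> (\<forall>t\<in>set ts. P t)}
      \<subseteq> {ts. set ts \<subseteq> {t. nodes t \<le> n} \<and> length ts = m}"
    by (auto intro: member_le_sum_list)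
  show "finite {ts. set ts \<subseteq> {t. nodes t \<le> n} \<and> length ts = m}"
    by (rule finite_lists_length_eq[OF finite_nodes_le])
qed

lemma forest_gf:
  fixes \<phi> :: "real fps" and P :: "ptree \<Rightarrow> bool"
  defines "g \<equiv> Abs_fps (\<lambda>n. \<Sum>t | nodes t = n \<and> P t. weight \<phi> t)"
  shows "(\<Sum>ts | length ts = m \<and> sum_list (map nodes ts) = n \<and> (\<forall>t\<in>set ts. P t).
            prod_list (map (weight \<phi>) ts)) = fps_nth (g ^ m) n"
proof (induction m arbitrary: n)
  case 0
  have "{ts :: ptree list. length ts = 0 \<and> sum_list (map nodes ts) = n \<and> (\<forall>t\<in>set ts. P t)} =
        (if n = 0 then {[]} else {})" by auto
  then show ?case by simp
next
  case (Suc m)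
  let ?F = "\<lambda>m n. {ts. length ts = m \<and> sum_list (map nodes ts) = n \<and> (\<forall>t\<in>set ts. P t)}"
  let ?G = "\<lambda>i. {t. nodes t = i \<and> P t}"
  note finF = finite_forests
  have finG: "finite (?G i)" for i
    by (rule finite_subset[OF _ finite_nodes_eq[of i]]) auto
  have bij: "bij_betw (\<lambda>(i, t, ts). t # ts) (SIGMA i:{0..n}. ?G i \<times> ?F m (n - i)) (?F (Suc m) n)"
    by (rule bij_betw_byWitness[where f' = "\<lambda>ts. (nodes (hd ts), hd ts, tl ts)"])
       (auto simp: length_Suc_conv)
  have "(\<Sum>ts\<in>?F (Suc m) n. prod_list (map (weight \<phi>) ts)) =
        (\<Sum>x\<in>(SIGMA i:{0..n}. ?G i \<times> ?F m (n - i)).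
           prod_list (map (weight \<phi>) ((\<lambda>(i, t, ts). t # ts) x)))"
    by (rule sum.reindex_bij_betw[OF bij, symmetric])
  also have "\<dots> = (\<Sum>x\<in>(SIGMA i:{0..n}. ?G i \<times> ?F m (n - i)).
      (case x of (i, t, ts) \<Rightarrow> weight \<phi> t * prod_list (map (weight \<phi>) ts)))"
    by (intro sum.cong) auto
  also have "\<dots> = (\<Sum>i=0..n. \<Sum>(t, ts)\<in>?G i \<times> ?F m (n - i).
      weight \<phi> t * prod_list (map (weight \<phi>) ts))"
    by (subst sum.Sigma) (auto intro: finF finG)
  also have "\<dots> = (\<Sum>i=0..n. (\<Sum>t\<in>?G i. weight \<phi> t) *
      (\<Sum>ts\<in>?F m (n - i). prod_list (map (weight \<phi>) ts)))"
    by (simp add: sum_product sum.cartesian_product)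
  also have "\<dots> = fps_nth (g ^ Suc m) n"
    by (simp add: Suc fps_mult_nth g_def)
  finally show ?case .
qed

lemma forest_weighted_gf:
  fixes \<phi> :: "real fps" and P :: "ptree \<Rightarrow> bool"
  defines "g \<equiv> Abs_fps (\<lambda>n. \<Sum>t | nodes t = n \<and> P t. weight \<phi> t)"
  assumes Q: "\<And>ts. Q (Node ts) \<longleftrightarrow> length ts \<in> M \<and> (\<forall>t\<in>set ts. P t)"
  shows "fps_nth (Abs_fps (\<lambda>n. \<Sum>t | nodes t = n \<and> Q t. weight \<phi> t)) (Suc n) =
    (\<Sum>m\<in>{0..n} \<inter> M. fps_nth \<phi> m * fps_nth (g ^ m) n)"
proof -
  let ?F = "\<lambda>m. {ts. length ts = m \<and> sum_list (map nodes ts) = n \<and> (\<forall>t\<in>set ts. P t)}"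
  let ?w = "\<lambda>ts. fps_nth \<phi> (length ts) * prod_list (map (weight \<phi>) ts)"
  note finF = finite_forests
  have set_eq: "{t. nodes t = Suc n \<and> Q t} = Node ` (\<Union>m\<in>{0..n} \<inter> M. ?F m)"
  proof (intro set_eqI iffI)
    fix t assume t: "t \<in> {t. nodes t = Suc n \<and> Q t}"
    obtain ts where ts: "t = Node ts" by (cases t)
    then show "t \<in> Node ` (\<Union>m\<in>{0..n} \<inter> M. ?F m)"
      using t Q length_le_sum_nodes[of ts] by auto
  qed (auto simp: Q)
  have "(\<Sum>t | nodes t = Suc n \<and> Q t. weight \<phi> t) = (\<Sum>ts\<in>(\<Union>m\<in>{0..n} \<inter> M. ?F m). ?w ts)"
    unfolding set_eq by (subst sum.reindex) (auto simp: inj_on_def)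
  also have "\<dots> = (\<Sum>m\<in>{0..n} \<inter> M. \<Sum>ts\<in>?F m. ?w ts)"
    by (rule sum.UNION_disjoint) (auto intro: finF)
  also have "\<dots> = (\<Sum>m\<in>{0..n} \<inter> M. fps_nth \<phi> m * fps_nth (g ^ m) n)"
    unfolding g_def forest_gf[symmetric] by (simp add: sum_distrib_left)
  finally show ?thesis by simp
qed

lemma nodes_0_empty: "{t. nodes t = 0 \<and> Q t} = {}"
proof -
  have "nodes t \<noteq> 0" for t using nodes_pos[of t] by simp
  then show ?thesis by blast
qed

theorem tree_gf_eq: "tree_gf \<phi> = fps_X * (fps_compose \<phi> (tree_gf \<phi>))"
proof (rule fps_ext)
  fix n
  show "fps_nth (tree_gf \<phi>) n = fps_nth (fps_X * (fps_compose \<phi> (tree_gf \<phi>))) n"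
  proof (cases n)
    case 0
    have "{t. nodes t = 0} = {}" using nodes_0_empty[of "\<lambda>_. True"] by simp
    then have "(\<Sum>t | nodes t = 0. weight \<phi> t) = 0" by (metis sum.empty)
    then show ?thesis using 0 by (simp add: tree_gf_def)
  next
    case (Suc m)
    then show ?thesis
      using forest_weighted_gf[of "\<lambda>_. True" UNIV "\<lambda>_. True" \<phi> m]
      by (simp add: tree_gf_def fps_compose_nth)
  qed
qed

theorem prot_gf_Suc:
  "prot_gf \<phi> (Suc k) = fps_X * (fps_compose \<phi> (prot_gf \<phi> k) - fps_const (fps_nth \<phi> 0))"
proof (rule fps_ext)
  fix n
  show "fps_nth (prot_gf \<phi> (Suc k)) n =
    fps_nth (fps_X * (fps_compose \<phi> (prot_gf \<phi> k) - fps_const (fps_nth \<phi> 0))) n"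
  proof (cases n)
    case 0
    have "(\<Sum>t | nodes t = 0 \<and> Suc k \<le> protection t. weight \<phi> t) = 0"
      by (subst nodes_0_empty) (rule sum.empty)
    then show ?thesis using 0 by (simp add: prot_gf_def)
  next
    case (Suc m)
    have "fps_nth (prot_gf \<phi> (Suc k)) (Suc m) =
        (\<Sum>i\<in>{0..m} \<inter> {0<..}. fps_nth \<phi> i * fps_nth (prot_gf \<phi> k ^ i) m)"
      unfolding prot_gf_def
      by (rule forest_weighted_gf) (simp add: Suc_le_protection_iff)
    also have "{0..m} \<inter> {0<..} = {0..m} - {0}" by auto
    also have "(\<Sum>i\<in>{0..m} - {0}. fps_nth \<phi> i * fps_nth (prot_gf \<phi> k ^ i) m) =
        fps_nth (fps_compose \<phi> (prot_gf \<phi> k) - fps_const (fps_nth \<phi> 0)) m"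
      by (subst sum_diff1) (auto simp: fps_compose_nth)
    finally show ?thesis using Suc by simp
  qed
qed

end

theory Submission
  imports Defs "HOL-Probability.Characteristic_Functions" "HOL-Real_Asymp.Real_Asymp"
begin

text \<open>
  Tilting the weights to \<open>p\<^sub>j = \<phi>\<^sub>j \<tau>\<^sup>j / \<phi>(\<tau>)\<close> multiplies the weight of every tree with \<open>n\<close> nodes by
  \<open>\<rho>\<^sup>n / \<tau>\<close>, where \<open>\<rho> = \<tau> / \<phi>(\<tau>)\<close> (\<open>weight_tilt\<close>). The random tree of size \<open>n\<close> is therefore unchanged,
  and \<open>p\<close> is a probability distribution of mean 1 with exponential moments: the trees become the
  family trees of a critical branching process, and \<open>\<rho>\<close> and \<open>\<tau>\<close> are moved to 1. Most of the
  argument takes place in the locale \<open>critical_offspring\<close> that describes this situation.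

  Write \<open>a\<^sub>n\<close> for the probability that such a family tree has \<open>n\<close> nodes, and \<open>b\<^sub>k\<^sub>,\<^sub>n\<close> for the probability
  that in addition its protection number is at least \<open>k\<close>; then \<open>b\<^sub>k\<^sub>,\<^sub>n / a\<^sub>n\<close> is the probability that
  a random tree of size \<open>n\<close> has protection number at least \<open>k\<close>. The Otter--Dwass formula
  (\<open>otter_dwass\<close>) expresses \<open>a\<^sub>n\<close> and all its convolution powers by coefficients of \<open>p\<^sup>n\<close>, and a
  local limit theorem for sums of independent variables with distribution \<open>p\<close> then gives
  \<open>a\<^sub>n \<sim> c n\<^sup>-\<^sup>3\<^sup>/\<^sup>2\<close> together with a bound on the powers that is uniform in the exponent. The local
  limit theorem is proved by Fourier inversion and dominated convergence; non-periodicity enters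
  through the decay of the characteristic function (\<open>cmod_chi_decay\<close>).

  A sequence of order \<open>n\<^sup>-\<^sup>3\<^sup>/\<^sup>2\<close> is subexponential: in a convolution only the two extreme ranges
  contribute, so that \<open>n\<^sup>3\<^sup>/\<^sup>2 [z\<^sup>n] f\<^sup>m\<close> tends to \<open>m f(1)\<^sup>m\<^sup>-\<^sup>1\<close> times the limit of \<open>n\<^sup>3\<^sup>/\<^sup>2 [z\<^sup>n] f\<close>
  (\<open>fps_power_limit\<close>). Applied to the recursion
  \<open>T\<^sub>k\<^sub>+\<^sub>1 = z (p(T\<^sub>k) - p\<^sub>0)\<close> this shows that \<open>b\<^sub>k\<^sub>,\<^sub>n / a\<^sub>n\<close> converges, and that passing from \<open>k\<close> to
  \<open>k + 1\<close> multiplies the limit by \<open>p'(T\<^sub>k(1))\<close> (\<open>prot_limit\<close>). Since \<open>T\<^sub>0(1) = 1\<close> and \<open>p'(1) = 1\<close>, the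
  first factor is 1, which is why the products in the theorem start at 1.

  Expectation and second moment are the sums of \<open>b\<^sub>k\<^sub>,\<^sub>n / a\<^sub>n\<close> over \<open>k \<ge> 1\<close>, with factors 1 and \<open>2 k - 1\<close>.
  To take the limit under the sum one needs a summable bound independent of \<open>n\<close>. It comes from
  \<open>T\<^sub>k(1) \<rightarrow> 0\<close>: for large \<open>k\<close> one step of the recursion multiplies the bound on \<open>n\<^sup>3\<^sup>/\<^sup>2 b\<^sub>k\<^sub>,\<^sub>n\<close> by
  roughly \<open>p\<^sub>1 < 1\<close>, so that \<open>b\<^sub>k\<^sub>,\<^sub>n\<close> decays geometrically in \<open>k\<close> (\<open>prot_geometric_bound\<close>).
\<close>

section \<open>Sequences of order \<open>n\<^sup>-\<^sup>3\<^sup>/\<^sup>2\<close>\<close>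

text \<open>
  Dominated convergence for series, in the form in which every interchange of limit and sum below
  uses it.
\<close>

lemma tannery_uniform:
  fixes a :: "nat \<Rightarrow> nat \<Rightarrow> real"
  assumes lim: "\<And>k. (\<lambda>n. a k n) \<longlonglongrightarrow> b k"
    and bound: "\<And>k n. n \<ge> N \<Longrightarrow> \<bar>a k n\<bar> \<le> M k" and M: "summable M"
  shows "summable b" "(\<lambda>n. \<Sum>k. a k n) \<longlonglongrightarrow> suminf b"
proof -
  have "\<forall>\<^sub>F (k, n) in at_top \<times>\<^sub>F sequentially. norm (a k n) \<le> M k"
    unfolding eventually_prod_filter
    by (rule exI[of _ "\<lambda>_. True"], rule exI[of _ "\<lambda>n. n \<ge> N"])
       (use bound eventually_ge_at_top in auto)
  from tannerys_theorem[OF lim this M] show "summable b" "(\<lambda>n. \<Sum>k. a k n) \<longlonglongrightarrow> suminf b"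
    by (auto intro: summable_norm_cancel)
qed

definition pow32 :: "nat \<Rightarrow> real" where
  "pow32 n = real n * sqrt (real n)"

lemma pow32_nonneg [simp]: "0 \<le> pow32 n"
  by (simp add: pow32_def)

lemma pow32_pos: "0 < n \<Longrightarrow> 0 < pow32 n"
  by (simp add: pow32_def)

lemma pow32_halving:
  assumes "2 * k \<le> n"
  shows "pow32 n \<le> 3 * pow32 (n - k)"
proof -
  have "real n \<le> 2 * real (n - k)"
    using assms by linarith
  then have "pow32 n \<le> (2 * real (n - k)) * sqrt (2 * real (n - k))"
    unfolding pow32_def by (intro mult_mono) auto
  also have "\<dots> = 2 * sqrt 2 * pow32 (n - k)"
    by (simp add: pow32_def real_sqrt_mult)
  also have "\<dots> \<le> 3 * pow32 (n - k)"
  proof (rule mult_right_mono)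
    have "sqrt 2 \<le> 3 / 2"
      by (rule real_le_lsqrt) (auto simp: power2_eq_square)
    then show "2 * sqrt 2 \<le> 3" by simp
  qed simp
  finally show ?thesis .
qed

lemma pow32_ratio_tendsto: "(\<lambda>n. pow32 n / pow32 (n - k)) \<longlonglongrightarrow> 1"
proof -
  have "(\<lambda>n. pow32 (n + k) / pow32 n) \<longlonglongrightarrow> 1"
    unfolding pow32_def by real_asymp
  then have "(\<lambda>n. pow32 (n + k) / pow32 (n + k - k)) \<longlonglongrightarrow> 1"
    by simp
  then show ?thesis
    by (rule LIMSEQ_offset)
qed

lemma summable_of_pow32_bounded:
  fixes f :: "nat \<Rightarrow> real"
  assumes "\<And>n. 0 \<le> f n" "\<And>n. pow32 n * f n \<le> K"
  shows "summable f"
proof (rule summable_comparison_test_ev)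
  show "summable (\<lambda>n. K * real n powr (- (3/2)))"
    by (intro summable_mult) (simp add: summable_real_powr_iff)
  show "\<forall>\<^sub>F n in sequentially. norm (f n) \<le> K * real n powr (- (3/2))"
    using eventually_gt_at_top[of 0]
  proof eventually_elim
    case (elim n)
    have "real n powr (3/2) = real n powr (1 + 1/2)" by simp
    also have "\<dots> = pow32 n"
      using elim by (subst powr_add) (simp add: pow32_def powr_half_sqrt)
    finally show ?case
      using assms[of n] pow32_pos[OF elim]
      by (simp add: powr_minus field_simps)
  qed
qed

lemma fps_mult_nth_halves:
  fixes f g :: "'a :: comm_semiring_0 fps"
  shows "fps_nth (f * g) n =
    (\<Sum>i | 2 * i \<le> n. fps_nth f i * fps_nth g (n - i)) +
    (\<Sum>i | 2 * i < n. fps_nth g i * fps_nth f (n - i))"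
proof -
  have "fps_nth (f * g) n = (\<Sum>i\<in>{i. 2 * i \<le> n} \<union> {i. i \<le> n \<and> n < 2 * i}. fps_nth f i * fps_nth g (n - i))"
    unfolding fps_mult_nth by (intro sum.cong) auto
  also have "\<dots> = (\<Sum>i | 2 * i \<le> n. fps_nth f i * fps_nth g (n - i)) +
      (\<Sum>i | i \<le> n \<and> n < 2 * i. fps_nth f i * fps_nth g (n - i))"
    by (intro sum.union_disjoint) (auto intro: finite_subset[of _ "{..n}"])
  also have "(\<Sum>i | i \<le> n \<and> n < 2 * i. fps_nth f i * fps_nth g (n - i)) =
      (\<Sum>i | 2 * i < n. fps_nth g i * fps_nth f (n - i))"
    by (rule sum.reindex_bij_witness[of _ "\<lambda>i. n - i" "\<lambda>i. n - i"]) (auto simp: mult.commute)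
  finally show ?thesis .
qed

text \<open>
  In the half of a convolution where \<open>i \<le> n / 2\<close> the other index is at least \<open>n / 2\<close>, so its
  weight is comparable to \<open>pow32 n\<close> and the sum over \<open>i\<close> costs only the total mass of \<open>f\<close>. The
  predicate \<open>Q\<close> allows for both \<open>2 * i \<le> n\<close> and \<open>2 * i < n\<close>, since the two halves of a convolution
  must not both contain the middle term.
\<close>

lemma half_convolution_bound:
  fixes f g :: "nat \<Rightarrow> real"
  assumes f: "\<And>n. 0 \<le> f n" "summable f" and g: "\<And>n. 0 \<le> g n" "\<And>n. pow32 n * g n \<le> K"
    and Q: "\<And>i. Q i \<Longrightarrow> 2 * i \<le> n"
  shows "pow32 n * (\<Sum>i | Q i. f i * g (n - i)) \<le> 3 * K * suminf f"
proof -
  have fin: "finite {i. Q i}"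
    by (rule finite_subset[of _ "{..n}"]) (use Q in fastforce)+
  have K: "0 \<le> K" using g(2)[of 0] by (simp add: pow32_def)
  have "pow32 n * (\<Sum>i | Q i. f i * g (n - i)) = (\<Sum>i | Q i. f i * (pow32 n * g (n - i)))"
    by (simp add: sum_distrib_left mult_ac)
  also have "\<dots> \<le> (\<Sum>i | Q i. f i * (3 * K))"
  proof (intro sum_mono mult_left_mono f)
    fix i assume "i \<in> {i. Q i}"
    then have "pow32 n * g (n - i) \<le> 3 * pow32 (n - i) * g (n - i)"
      using Q by (intro mult_right_mono pow32_halving g) auto
    also have "\<dots> \<le> 3 * K" using g(2)[of "n - i"] by simp
    finally show "pow32 n * g (n - i) \<le> 3 * K" .
  qed
  also have "\<dots> = 3 * K * (\<Sum>i | Q i. f i)"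
    by (simp add: sum_distrib_left mult_ac)
  also have "\<dots> \<le> 3 * K * suminf f"
    using K f fin by (intro mult_left_mono sum_le_suminf) auto
  finally show ?thesis .
qed

lemma convolution_bound:
  fixes f g :: "real fps"
  assumes f: "\<And>n. 0 \<le> fps_nth f n" "summable (fps_nth f)" "\<And>n. pow32 n * fps_nth f n \<le> D"
    and g: "\<And>n. 0 \<le> fps_nth g n" "summable (fps_nth g)" "\<And>n. pow32 n * fps_nth g n \<le> E"
  shows "pow32 n * fps_nth (f * g) n \<le> 3 * (E * suminf (fps_nth f) + D * suminf (fps_nth g))"
  unfolding fps_mult_nth_halves distrib_left
  using half_convolution_bound[OF f(1,2) g(1,3), of "\<lambda>i. 2 * i \<le> n" n]
    half_convolution_bound[OF g(1,2) f(1,3), of "\<lambda>i. 2 * i < n" n] by simp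

lemma half_convolution_limit:
  fixes f g :: "nat \<Rightarrow> real"
  assumes f: "\<And>n. 0 \<le> f n" "summable f" and g: "\<And>n. 0 \<le> g n" "(\<lambda>n. pow32 n * g n) \<longlonglongrightarrow> M"
    and Q: "\<And>n i. Q n i \<Longrightarrow> 2 * i \<le> n" "\<And>i. \<forall>\<^sub>F n in sequentially. Q n i"
  shows "(\<lambda>n. pow32 n * (\<Sum>i | Q n i. f i * g (n - i))) \<longlonglongrightarrow> suminf f * M"
proof -
  obtain K where K: "\<And>n. norm (pow32 n * g n) \<le> K"
    using convergent_imp_Bseq[OF convergentI[OF g(2)]] by (auto simp: Bseq_def)
  let ?a = "\<lambda>i n. if Q n i then f i * (pow32 n * g (n - i)) else 0"
  have lim: "(\<lambda>n. ?a i n) \<longlonglongrightarrow> f i * M" for i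
  proof (rule Lim_transform_eventually)
    have "(\<lambda>n. pow32 (n - i) * g (n - i)) \<longlonglongrightarrow> M"
      by (rule LIMSEQ_offset[of _ i]) (use g(2) in simp)
    then have "(\<lambda>n. f i * ((pow32 n / pow32 (n - i)) * (pow32 (n - i) * g (n - i)))) \<longlonglongrightarrow> f i * (1 * M)"
      by (intro tendsto_intros pow32_ratio_tendsto)
    then show "(\<lambda>n. f i * ((pow32 n / pow32 (n - i)) * (pow32 (n - i) * g (n - i)))) \<longlonglongrightarrow> f i * M"
      by simp
    show "\<forall>\<^sub>F n in sequentially. f i * ((pow32 n / pow32 (n - i)) * (pow32 (n - i) * g (n - i))) = ?a i n"
      using Q(2)[of i] eventually_gt_at_top[of i]
    proof eventually_elim
      case (elim n)
      then show ?case using pow32_pos[of "n - i"] by simp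
    qed
  qed
  have bound: "norm (?a i n) \<le> f i * (3 * K)" for i n
  proof (cases "Q n i")
    case True
    have "pow32 n * g (n - i) \<le> 3 * pow32 (n - i) * g (n - i)"
      using Q(1)[OF True] by (intro mult_right_mono pow32_halving g)
    also have "\<dots> \<le> 3 * K" using K[of "n - i"] by simp
    finally show ?thesis using True f(1)[of i] g(1)[of "n - i"]
      by (auto simp: abs_mult intro: mult_left_mono)
  next
    case False
    have "0 \<le> K" using K[of 0] by (simp add: pow32_def)
    then show ?thesis using False f(1)[of i] by simp
  qed
  have "(\<lambda>n. \<Sum>i. ?a i n) \<longlonglongrightarrow> (\<Sum>i. f i * M)"
    using lim bound f(2)
    by (intro tannery_uniform(2)[where N = 0 and M = "\<lambda>i. f i * (3 * K)"]) (auto intro: summable_mult2)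
  moreover have "(\<Sum>i. ?a i n) = pow32 n * (\<Sum>i | Q n i. f i * g (n - i))" for n
  proof -
    have "finite {i. Q n i}"
      by (rule finite_subset[of _ "{..n}"]) (use Q(1)[of n] in fastforce)+
    then have "(\<Sum>i. ?a i n) = (\<Sum>i | Q n i. ?a i n)"
      by (intro suminf_finite) auto
    then show ?thesis by (simp add: sum_distrib_left mult_ac)
  qed
  ultimately show ?thesis using f(2) by (simp add: suminf_mult2)
qed

text \<open>
  When an index \<open>n\<close> is split into two, the main contributions come from splits in which one part
  stays bounded while the other is close to \<open>n\<close>. The bounded part contributes the total mass of its
  sequence, the other part the limit.
\<close>

lemma convolution_limit:
  fixes f g :: "real fps"
  assumes f: "\<And>n. 0 \<le> fps_nth f n" "summable (fps_nth f)" "(\<lambda>n. pow32 n * fps_nth f n) \<longlonglongrightarrow> L"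
    and g: "\<And>n. 0 \<le> fps_nth g n" "summable (fps_nth g)" "(\<lambda>n. pow32 n * fps_nth g n) \<longlonglongrightarrow> M"
  shows "(\<lambda>n. pow32 n * fps_nth (f * g) n) \<longlonglongrightarrow> suminf (fps_nth f) * M + suminf (fps_nth g) * L"
  unfolding fps_mult_nth_halves distrib_left
  by (intro tendsto_add half_convolution_limit f g)
     (auto intro: eventually_mono[OF eventually_ge_at_top[of "2 * _"]]
        eventually_mono[OF eventually_gt_at_top[of "2 * _"]])

lemma fps_nth_mult_nonneg:
  fixes f g :: "real fps"
  assumes "\<And>n. 0 \<le> fps_nth f n" "\<And>n. 0 \<le> fps_nth g n"
  shows "0 \<le> fps_nth (f * g) n"
  unfolding fps_mult_nth using assms by (intro sum_nonneg mult_nonneg_nonneg) auto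

lemma fps_nth_power_nonneg:
  fixes f :: "real fps"
  assumes "\<And>n. 0 \<le> fps_nth f n"
  shows "0 \<le> fps_nth (f ^ m) n"
proof (induction m arbitrary: n)
  case (Suc m)
  then show ?case using assms by (simp add: fps_nth_mult_nonneg)
qed simp

lemma fps_nth_power_mono:
  fixes f g :: "real fps"
  assumes "\<And>n. 0 \<le> fps_nth f n" "\<And>n. fps_nth f n \<le> fps_nth g n"
  shows "fps_nth (f ^ m) n \<le> fps_nth (g ^ m) n"
proof (induction m arbitrary: n)
  case (Suc m)
  have "0 \<le> fps_nth g n" for n using assms order_trans by blast
  then show ?case
    unfolding power_Suc fps_mult_nth
    using assms Suc fps_nth_power_nonneg[OF assms(1)]
    by (intro sum_mono mult_mono) auto
qed simp

lemma fps_power_sums: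
  fixes f :: "real fps"
  assumes "\<And>n. 0 \<le> fps_nth f n" "summable (fps_nth f)"
  shows "fps_nth (f ^ m) sums suminf (fps_nth f) ^ m"
proof (induction m)
  case 0
  show ?case using sums_single[of 0 "\<lambda>_. 1 :: real"] by (auto simp: fps_one_nth[abs_def] eq_commute)
next
  case (Suc m)
  have "(\<lambda>k. \<Sum>i\<le>k. fps_nth f i * fps_nth (f ^ m) (k - i)) sums
      (suminf (fps_nth f) * suminf (fps_nth (f ^ m)))"
    using assms Suc fps_nth_power_nonneg[OF assms(1), of m]
    by (intro Cauchy_product_sums) (auto simp: sums_iff)
  then show ?case
    using Suc by (simp add: sums_iff fps_mult_nth[abs_def] atLeast0AtMost)
qed

text \<open>
  The constant grows exponentially in \<open>m\<close>, but its base is proportional to the total mass of \<open>f\<close>.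
  This is what makes the bound useful for generating functions of small mass.
\<close>

lemma fps_power_bound:
  fixes f :: "real fps"
  assumes f: "\<And>n. 0 \<le> fps_nth f n" "summable (fps_nth f)" "\<And>n. pow32 n * fps_nth f n \<le> D"
  shows "pow32 n * fps_nth (f ^ Suc m) n \<le> D * (6 * suminf (fps_nth f)) ^ m"
proof (induction m arbitrary: n)
  case (Suc m)
  let ?F = "suminf (fps_nth f)"
  have F: "0 \<le> ?F" using f by (simp add: suminf_nonneg)
  have D: "0 \<le> D" using f(3)[of 0] by (simp add: pow32_def)
  have s: "fps_nth (f ^ Suc m) sums (?F ^ Suc m)" by (rule fps_power_sums[OF f(1,2)])
  have "pow32 n * fps_nth (f * f ^ Suc m) n \<le> 3 * (D * (6 * ?F) ^ m * ?F + D * ?F ^ Suc m)"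
    using convolution_bound[OF f fps_nth_power_nonneg[OF f(1)] sums_summable[OF s] Suc]
    by (simp only: sums_unique[OF s, symmetric])
  also have "D * ?F ^ Suc m \<le> D * (6 * ?F) ^ m * ?F"
    using D F mult_left_mono[of 1 "6 ^ m" "D * ?F ^ Suc m"]
    by (simp add: power_mult_distrib mult_ac)
  finally show ?case by (simp add: mult_ac)
qed (use f in simp)

lemma fps_power_limit:
  fixes f :: "real fps"
  assumes f: "\<And>n. 0 \<le> fps_nth f n" "summable (fps_nth f)" "(\<lambda>n. pow32 n * fps_nth f n) \<longlonglongrightarrow> L"
  shows "(\<lambda>n. pow32 n * fps_nth (f ^ m) n) \<longlonglongrightarrow> real m * suminf (fps_nth f) ^ (m - 1) * L"
proof (induction m)
  case 0
  have "pow32 n * fps_nth (1 :: real fps) n = 0" for n by (cases n) (auto simp: pow32_def)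
  then show ?case by (simp only: power_0 of_nat_0 mult_zero_left tendsto_const)
next
  case (Suc m)
  let ?F = "suminf (fps_nth f)"
  have s: "fps_nth (f ^ m) sums (?F ^ m)" by (rule fps_power_sums[OF f(1,2)])
  have "(\<lambda>n. pow32 n * fps_nth (f * f ^ m) n) \<longlonglongrightarrow>
      ?F * (real m * ?F ^ (m - 1) * L) + ?F ^ m * L"
    using convolution_limit[OF f fps_nth_power_nonneg[OF f(1)] sums_summable[OF s] Suc]
    by (simp only: sums_unique[OF s, symmetric])
  also have "?F * (real m * ?F ^ (m - 1) * L) + ?F ^ m * L = real (Suc m) * ?F ^ (Suc m - 1) * L"
    by (cases m) (auto simp: algebra_simps)
  finally show ?case by simp
qed

text \<open>
  Evaluation at 1, which may lie on the boundary of the disc of convergence of \<open>g\<close>: as all terms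
  are non-negative, the double series can be summed in either order.
\<close>

lemma fps_compose_sums:
  fixes f g :: "real fps"
  assumes f: "\<And>n. 0 \<le> fps_nth f n" and g: "\<And>n. 0 \<le> fps_nth g n" "fps_nth g 0 = 0" "summable (fps_nth g)"
    and S: "(\<lambda>m. fps_nth f m * suminf (fps_nth g) ^ m) sums S"
  shows "fps_nth (fps_compose f g) sums S"
proof -
  let ?h = "\<lambda>(m, n). fps_nth f m * fps_nth (g ^ m) n"
  have h: "((\<lambda>n. ?h (m, n)) has_sum fps_nth f m * suminf (fps_nth g) ^ m) UNIV" for m
    using fps_power_sums[OF g(1,3), of m] f fps_nth_power_nonneg[OF g(1), of m]
    by (auto intro!: sums_nonneg_imp_has_sum sums_mult)
  have "((\<lambda>m. fps_nth f m * suminf (fps_nth g) ^ m) has_sum S) UNIV"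
    using S f g by (intro sums_nonneg_imp_has_sum) (auto simp: suminf_nonneg)
  then have "(?h has_sum S) (UNIV \<times> UNIV)"
    using h f fps_nth_power_nonneg[OF g(1)]
    by (intro has_sum_SigmaI summable_on_SigmaI) (auto simp: has_sum_imp_summable)
  then have "((\<lambda>(n, m). ?h (m, n)) has_sum S) (UNIV \<times> UNIV)"
    by (subst (asm) has_sum_swap)
  then have "(fps_nth (fps_compose f g) has_sum S) UNIV"
  proof (rule has_sum_SigmaD)
    fix n :: nat
    have "((\<lambda>m. fps_nth f m * fps_nth (g ^ m) n) has_sum
        (\<Sum>m=0..n. fps_nth f m * fps_nth (g ^ m) n)) UNIV"
      by (rule has_sum_finite_neutralI)
         (auto simp: startsby_zero_power_prefix[OF g(2)])
    then show "((\<lambda>m. case (n, m) of (n, m) \<Rightarrow> ?h (m, n)) has_sum fps_nth (fps_compose f g) n) UNIV"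
      by (simp add: fps_compose_nth)
  qed
  then show ?thesis by (rule has_sum_imp_sums)
qed

section \<open>The Otter--Dwass formula\<close>

text \<open>
  Lagrange inversion for \<open>T = z p(T)\<close>, by induction on \<open>n\<close>. The recursion gives
  \<open>[z\<^sup>n] T\<^sup>m = [z\<^sup>n\<^sup>-\<^sup>m] p(T)\<^sup>m\<close>, a sum of \<open>[u\<^sup>j] p\<^sup>m\<close> times \<open>[z\<^sup>n\<^sup>-\<^sup>m] T\<^sup>j\<close>, to which the induction
  hypothesis applies; the factor \<open>j\<close> that it produces turns \<open>p\<^sup>m\<close> into \<open>u (p\<^sup>m)'\<close>, and
  \<open>(p\<^sup>m)' p\<^sup>n\<^sup>-\<^sup>m = (m / n) (p\<^sup>n)'\<close>.
\<close>

lemma otter_dwass: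
  fixes T p :: "real fps"
  assumes T: "T = fps_X * fps_compose p T"
  shows "real n * fps_nth (T ^ m) n = real m * (if m \<le> n then fps_nth (p ^ n) (n - m) else 0)"
proof (induction n arbitrary: m rule: less_induct)
  case (less n)
  have T0: "fps_nth T 0 = 0" by (subst T) simp
  show ?case
  proof (cases "0 < m \<and> m < n")
    case False
    consider "m = 0" | "n < m" | "m = n" "0 < n" using False by fastforce
    then show ?thesis
    proof cases
      case 1
      then show ?thesis by (cases n) auto
    next
      case 2
      then show ?thesis using startsby_zero_power_prefix[OF T0, of m] by simp
    next
      case 3
      have "T ^ n = fps_X ^ n * fps_compose p T ^ n"
        by (subst T) (simp add: power_mult_distrib)
      then have "fps_nth (T ^ n) n = fps_nth (p ^ n) 0"
        by (simp add: fps_X_power_mult_nth fps_nth_power_0)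
      then show ?thesis using 3 by simp
    qed
  next
    case True
    define l where "l = n - m"
    have l: "0 < l" "n = l + m" using True by (auto simp: l_def)
    have "T ^ m = fps_X ^ m * fps_compose (p ^ m) T"
      by (subst T) (simp add: power_mult_distrib fps_compose_power[OF T0])
    then have "fps_nth (T ^ m) n = fps_nth (fps_compose (p ^ m) T) l"
      using True by (simp add: fps_X_power_mult_nth l_def)
    also have "\<dots> = (\<Sum>j=0..l. fps_nth (p ^ m) j * fps_nth (T ^ j) l)"
      by (simp add: fps_compose_nth)
    finally have "real l * fps_nth (T ^ m) n = (\<Sum>j=0..l. fps_nth (p ^ m) j * (real l * fps_nth (T ^ j) l))"
      by (simp add: sum_distrib_left mult_ac)
    also have "\<dots> = (\<Sum>j=0..l. (real j * fps_nth (p ^ m) j) * fps_nth (p ^ l) (l - j))"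
    proof (intro sum.cong refl)
      fix j assume "j \<in> {0..l}"
      then show "fps_nth (p ^ m) j * (real l * fps_nth (T ^ j) l) =
          real j * fps_nth (p ^ m) j * fps_nth (p ^ l) (l - j)"
        using less[of l j] True by (simp add: l_def)
    qed
    also have "\<dots> = fps_nth ((fps_X * fps_deriv (p ^ m)) * p ^ l) l"
      unfolding fps_mult_nth[of "fps_X * _"]
      by (intro sum.cong) (auto simp: gr0_conv_Suc)
    also have "(fps_X * fps_deriv (p ^ m)) * p ^ l = fps_const (real m) * (fps_X * (fps_deriv p * p ^ (n - 1)))"
    proof -
      have "p ^ (n - 1) = p ^ (m - 1) * p ^ l"
        using True by (simp add: l_def flip: power_add)
      then show ?thesis by (simp add: fps_deriv_power' mult_ac fps_of_nat)
    qed
    finally have *: "real l * fps_nth (T ^ m) n = real m * fps_nth (fps_X * (fps_deriv p * p ^ (n - 1))) l"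
      by (simp only: fps_mult_left_const_nth)
    have "fps_X * fps_deriv (p ^ n) = fps_const (real n) * (fps_X * (fps_deriv p * p ^ (n - 1)))"
      by (simp add: fps_deriv_power' mult_ac fps_of_nat)
    then have "real n * fps_nth (fps_X * (fps_deriv p * p ^ (n - 1))) l = fps_nth (fps_X * fps_deriv (p ^ n)) l"
      by (simp only: fps_mult_left_const_nth)
    also have "\<dots> = real l * fps_nth (p ^ n) l"
      by (auto simp: gr0_conv_Suc)
    finally have "real l * (real n * fps_nth (T ^ m) n) = real l * (real m * fps_nth (p ^ n) l)"
      using * by (metis mult.left_commute)
    then show ?thesis using l(1) True by (simp add: l_def)
  qed
qed

section \<open>Fourier inversion\<close>

lemma term_le_of_sums_nonneg:
  fixes f :: "nat \<Rightarrow> real"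
  assumes "f sums S" "\<And>j. 0 \<le> f j"
  shows "f l \<le> S"
  using sum_le_suminf[of f "{l}"] assms by (simp add: sums_iff)

lemma abs_sin_add_le: "\<bar>sin (x + y :: real)\<bar> \<le> \<bar>sin x\<bar> + \<bar>sin y\<bar>"
proof -
  have "\<bar>sin (x + y)\<bar> \<le> \<bar>sin x * cos y\<bar> + \<bar>cos x * sin y\<bar>"
    unfolding sin_add by (rule abs_triangle_ineq)
  also have "\<dots> \<le> \<bar>sin x\<bar> * 1 + 1 * \<bar>sin y\<bar>"
    unfolding abs_mult by (intro add_mono mult_mono) auto
  finally show ?thesis by simp
qed

lemma abs_sin_diff_le: "\<bar>sin (x - y :: real)\<bar> \<le> \<bar>sin x\<bar> + \<bar>sin y\<bar>"
  using abs_sin_add_le[of x "-y"] by simp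

lemma abs_sin_int_mult_le: "\<bar>sin (of_int m * x :: real)\<bar> \<le> \<bar>of_int m\<bar> * \<bar>sin x\<bar>"
proof -
  have *: "\<bar>sin (of_nat n * x)\<bar> \<le> of_nat n * \<bar>sin x\<bar>" for n
  proof (induction n)
    case (Suc n)
    have "\<bar>sin (x + of_nat n * x)\<bar> \<le> \<bar>sin x\<bar> + of_nat n * \<bar>sin x\<bar>"
      using abs_sin_add_le[of x "of_nat n * x"] Suc by linarith
    then show ?case by (simp add: algebra_simps)
  qed simp
  have "\<bar>sin (of_int m * x)\<bar> = \<bar>sin (\<bar>of_int m\<bar> * x)\<bar>"
    by (cases "0 \<le> m") simp_all
  then show ?thesis
    using *[of "nat \<bar>m\<bar>"] by simp
qed

text \<open>
  From \<open>sin (2 z) = 2 sin z cos z\<close> at \<open>z = \<bar>\<theta>\<bar> / 4\<close>: by the mean value theorem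
  \<open>sin z \<ge> z cos z\<close>, and \<open>cos\<^sup>2 z \<ge> 1 / 2\<close> because \<open>z \<le> \<pi> / 4\<close>.
\<close>

lemma abs_sin_half_ge:
  assumes "\<bar>\<theta>\<bar> \<le> pi"
  shows "\<bar>\<theta>\<bar> / 4 \<le> \<bar>sin (\<theta> / 2)\<bar>"
proof -
  let ?z = "\<bar>\<theta>\<bar> / 4"
  have z: "0 \<le> ?z" "?z \<le> pi / 4" using assms by auto
  have half: "1 / 2 \<le> (cos ?z)\<^sup>2"
  proof -
    have "cos (pi / 4) \<le> cos ?z" using z by (intro cos_monotone_0_pi_le) auto
    then have "(cos (pi / 4))\<^sup>2 \<le> (cos ?z)\<^sup>2"
      by (intro power_mono) (auto simp: cos_45)
    then show ?thesis by (simp add: cos_45 power_divide)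
  qed
  have pos: "0 \<le> cos ?z" using z by (intro cos_ge_zero) auto
  have "?z * cos ?z \<le> sin ?z"
  proof (cases "?z = 0")
    case False
    then have "0 < ?z" using z by simp
    then obtain \<xi> where \<xi>: "0 < \<xi>" "\<xi> < ?z" "sin ?z - sin 0 = (?z - 0) * cos \<xi>"
      using MVT2[of 0 ?z sin cos] by (auto intro: DERIV_sin)
    have "cos ?z \<le> cos \<xi>" using \<xi> z by (intro cos_monotone_0_pi_le) auto
    then have "?z * cos ?z \<le> ?z * cos \<xi>" using z by (intro mult_left_mono)
    then show ?thesis using \<xi>(3) by simp
  qed simp
  then have "?z * cos ?z * cos ?z \<le> sin ?z * cos ?z"
    using pos by (rule mult_right_mono)
  moreover have "?z * (1 / 2) \<le> ?z * (cos ?z)\<^sup>2"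
    using half z by (intro mult_left_mono)
  ultimately have "?z \<le> sin (2 * ?z)"
    unfolding sin_double by (simp add: power2_eq_square)
  also have "\<dots> \<le> \<bar>sin (\<bar>\<theta>\<bar> / 2)\<bar>" by simp
  also have "\<dots> = \<bar>sin (\<theta> / 2)\<bar>" by (simp add: abs_if)
  finally show ?thesis .
qed

lemma has_bochner_integral_gaussian:
  assumes "0 < (a :: real)"
  shows "has_bochner_integral lborel (\<lambda>x. exp (- (a * x\<^sup>2))) (sqrt (pi / a))"
proof -
  define s where "s = sqrt (1 / (2 * a))"
  have s: "0 < s" "s\<^sup>2 = 1 / (2 * a)" using assms by (auto simp: s_def)
  have "has_bochner_integral lborel (\<lambda>x. sqrt (pi / a) * normal_density 0 s x) (sqrt (pi / a) * 1)"
    using s integrable_normal_density integral_normal_density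
    by (intro has_bochner_integral_mult_right) (auto simp: has_bochner_integral_iff)
  moreover have "sqrt (pi / a) * normal_density 0 s x = exp (- (a * x\<^sup>2))" for x
  proof -
    have "2 * pi * s\<^sup>2 = pi / a" using s assms by (simp add: field_simps)
    moreover have "(x - 0)\<^sup>2 / (2 * s\<^sup>2) = a * x\<^sup>2" using s assms by (simp add: field_simps)
    moreover have "0 < sqrt (pi / a)" using assms by simp
    ultimately show ?thesis using assms by (simp add: normal_density_def)
  qed
  ultimately show ?thesis by simp
qed

lemma integral_cis_period:
  "has_bochner_integral lborel (\<lambda>\<theta>. indicator {-pi..pi} \<theta> *\<^sub>R cis (of_int m * \<theta>))
     (if m = 0 then of_real (2 * pi) else 0)"
proof (cases "m = 0")
  case True
  have "has_bochner_integral lborel (\<lambda>\<theta>. indicator {-pi..pi} \<theta> *\<^sub>R (1::complex)) (of_real (2 * pi))"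
    by (auto simp: has_bochner_integral_iff scaleR_conv_of_real)
  then show ?thesis using True by simp
next
  case False
  let ?F = "\<lambda>\<theta>. cis (of_int m * \<theta>) / (\<i> * of_int m)"
  have "has_bochner_integral lborel (\<lambda>\<theta>. indicator {-pi..pi} \<theta> *\<^sub>R cis (of_int m * \<theta>)) (?F pi - ?F (-pi))"
  proof (rule has_bochner_integral_FTC_Icc)
    fix \<theta> :: real
    show "(?F has_vector_derivative cis (of_int m * \<theta>)) (at \<theta> within {-pi..pi})"
    proof -
      have "((\<lambda>z. exp (\<i> * of_int m * z) / (\<i> * of_int m)) has_field_derivative exp (\<i> * of_int m * of_real \<theta>))
          (at (of_real \<theta>))"
        using False by (auto intro!: derivative_eq_intros)
      from has_vector_derivative_real_field[OF this]
      show ?thesis by (simp add: cis_conv_exp mult_ac)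
    qed
  qed (auto intro!: continuous_intros)
  moreover have "cis (of_int m * pi) = cis (of_int m * (- pi))"
    using sin_integer_2pi[of m] sin_zero_iff_int2[of "of_int m * pi"] by (auto simp: complex_eq_iff)
  ultimately show ?thesis using False by simp
qed

lemma fourier_coefficient:
  fixes q :: "nat \<Rightarrow> real"
  assumes q: "\<And>j. 0 \<le> q j" "summable q"
  shows "has_bochner_integral lborel
     (\<lambda>\<theta>. indicator {-pi..pi} \<theta> *\<^sub>R ((\<Sum>j. of_real (q j) * cis (real j * \<theta>)) * cis (- (real k * \<theta>))))
     (of_real (2 * pi * q k))"
proof -
  let ?f = "\<lambda>j \<theta>. indicator {-pi..pi} \<theta> *\<^sub>R (of_real (q j) * cis (real j * \<theta>) * cis (- (real k * \<theta>)))"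
  have hb: "has_bochner_integral lborel (?f j) (if j = k then of_real (2 * pi * q k) else 0)" for j
  proof -
    have "?f j = (\<lambda>\<theta>. of_real (q j) * (indicator {-pi..pi} \<theta> *\<^sub>R cis (of_int (int j - int k) * \<theta>)))"
      by (auto simp: fun_eq_iff cis_mult algebra_simps indicator_def)
    then show ?thesis
      using has_bochner_integral_mult_right[OF integral_cis_period[of "int j - int k"], of "of_real (q j)"]
      by (auto simp: mult_ac split: if_splits)
  qed
  have norm_f: "norm (?f j \<theta>) = q j * indicator {-pi..pi} \<theta>" for j \<theta>
    using q by (simp add: norm_mult indicator_def)
  have int: "integrable lborel (?f j)" for j
    using hb[of j] by (simp add: has_bochner_integral_iff)
  have ae: "AE \<theta> in lborel. summable (\<lambda>j. norm (?f j \<theta>))"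
    unfolding norm_f using q by (intro AE_I2 summable_mult2)
  have sm: "summable (\<lambda>j. LINT \<theta>|lborel. norm (?f j \<theta>))"
    unfolding norm_f using q by (simp add: summable_mult2)
  have sumf: "(\<Sum>j. ?f j \<theta>) =
      indicator {-pi..pi} \<theta> *\<^sub>R ((\<Sum>j. of_real (q j) * cis (real j * \<theta>)) * cis (- (real k * \<theta>)))" for \<theta>
  proof -
    have "summable (\<lambda>j. norm (of_real (q j) * cis (real j * \<theta>)))"
      using q by (simp add: norm_mult)
    then have "summable (\<lambda>j. of_real (q j) * cis (real j * \<theta>))"
      by (rule summable_norm_cancel)
    then show ?thesis
      by (simp add: suminf_mult2 suminf_scaleR_right[symmetric] summable_mult2)
  qed
  have "(\<lambda>j. integral\<^sup>L lborel (?f j)) sums (LINT \<theta>|lborel. (\<Sum>j. ?f j \<theta>))"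
    using sums_integral[OF int ae sm] .
  moreover have "(\<lambda>j. integral\<^sup>L lborel (?f j)) = (\<lambda>j. if j = k then of_real (2 * pi * q k) else 0)"
    using hb by (auto simp: has_bochner_integral_iff fun_eq_iff)
  ultimately have "(\<lambda>j. if j = k then of_real (2 * pi * q k) else 0) sums (LINT \<theta>|lborel. (\<Sum>j. ?f j \<theta>))"
    by simp
  then have "(LINT \<theta>|lborel. (\<Sum>j. ?f j \<theta>)) = of_real (2 * pi * q k)"
    by (rule sums_unique2[OF _ sums_single])
  moreover have "integrable lborel (\<lambda>\<theta>. \<Sum>j. ?f j \<theta>)"
    using integrable_suminf[OF int ae sm] .
  ultimately show ?thesis
    unfolding sumf by (simp add: has_bochner_integral_iff)
qed

section \<open>A local limit theorem for critical offspring distributions\<close>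

locale critical_offspring =
  fixes p :: "real fps"
  assumes nonneg: "\<And>j. 0 \<le> fps_nth p j"
    and p0_pos: "0 < fps_nth p 0"
    and branching: "\<exists>j\<ge>2. 0 < fps_nth p j"
    and radius: "1 < fps_conv_radius p"
    and total: "eval_fps p 1 = 1"
    and mean: "eval_fps (fps_deriv p) 1 = 1"
    and nonperiodic: "nonperiodic p"
begin

lemma p_sums: "fps_nth p sums 1"
  using sums_eval_fps[of 1 p] radius total by (simp add: one_ereal_def)

lemma mean_sums: "(\<lambda>j. real j * fps_nth p j) sums 1"
proof -
  have "1 < fps_conv_radius (fps_deriv p)"
    using radius fps_conv_radius_deriv[of p] by (rule order_less_le_trans)
  then have "(\<lambda>j. real (Suc j) * fps_nth p (Suc j)) sums 1"
    using sums_eval_fps[of 1 "fps_deriv p"] mean by (simp add: one_ereal_def)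
  then show ?thesis by (subst (asm) sums_Suc_iff) simp
qed

lemma moment_summable: "summable (\<lambda>j. real j ^ k * fps_nth p j)"
proof -
  let ?D = "\<lambda>f :: real fps. fps_X * fps_deriv f"
  have nth: "fps_nth ((?D ^^ k) p) j = real j ^ k * fps_nth p j" for j
  proof (induction k)
    case (Suc k)
    have "fps_nth ((?D ^^ Suc k) p) j = real j * fps_nth ((?D ^^ k) p) j"
      by (cases j) auto
    then show ?case using Suc by simp
  qed simp
  have "1 < fps_conv_radius ((?D ^^ k) p)"
  proof (induction k)
    case (Suc k)
    have "1 < fps_conv_radius (fps_deriv ((?D ^^ k) p))"
      using Suc fps_conv_radius_deriv by (rule order_less_le_trans)
    then show ?case
      using fps_conv_radius_mult[of fps_X "fps_deriv ((?D ^^ k) p)"] by simp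
  qed (use radius in simp)
  then show ?thesis
    using summable_fps[of 1 "(?D ^^ k) p"] by (simp add: nth one_ereal_def)
qed

definition chi :: "real \<Rightarrow> complex" where
  "chi \<theta> = (\<Sum>j. of_real (fps_nth p j) * cis (real j * \<theta>))"

lemma chi_sums: "(\<lambda>j. of_real (fps_nth p j) * cis (real j * \<theta>)) sums chi \<theta>"
proof -
  have "summable (\<lambda>j. norm (of_real (fps_nth p j) * cis (real j * \<theta>)))"
    using p_sums nonneg by (simp add: norm_mult sums_iff)
  then show ?thesis
    unfolding chi_def by (rule summable_sums[OF summable_norm_cancel])
qed

lemma chi_power_sums: "(\<lambda>j. of_real (fps_nth (p ^ n) j) * cis (real j * \<theta>)) sums chi \<theta> ^ n"
proof (induction n)
  case 0
  have "(\<lambda>j. of_real (fps_nth (p ^ 0) j) * cis (real j * \<theta>)) = (\<lambda>j. if j = 0 then 1 else 0)"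
    by auto
  then show ?case using sums_single[of 0 "\<lambda>_. 1 :: complex"] by simp
next
  case (Suc n)
  let ?a = "\<lambda>n j. of_real (fps_nth (p ^ n) j) * cis (real j * \<theta>)"
  have sn: "summable (\<lambda>j. norm (?a n j))" for n
    using fps_power_sums[OF nonneg, of n] p_sums fps_nth_power_nonneg[OF nonneg, of n]
    by (simp add: norm_mult sums_iff)
  have "(\<lambda>k. \<Sum>i\<le>k. ?a 1 i * ?a n (k - i)) sums (suminf (?a 1) * suminf (?a n))"
    by (intro Cauchy_product_sums sn)
  also have "suminf (?a 1) * suminf (?a n) = chi \<theta> ^ Suc n"
    using sums_unique[OF Suc] by (simp add: chi_def)
  also have "(\<lambda>k. \<Sum>i\<le>k. ?a 1 i * ?a n (k - i)) = ?a (Suc n)"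
  proof
    fix k
    have "?a 1 i * ?a n (k - i) = of_real (fps_nth p i * fps_nth (p ^ n) (k - i)) * cis (real k * \<theta>)"
      if "i \<le> k" for i
    proof -
      have "cis (real i * \<theta>) * cis (real (k - i) * \<theta>) = cis (real k * \<theta>)"
        using that by (simp add: cis_mult algebra_simps of_nat_diff)
      moreover have "?a 1 i * ?a n (k - i) = of_real (fps_nth p i * fps_nth (p ^ n) (k - i)) *
          (cis (real i * \<theta>) * cis (real (k - i) * \<theta>))"
        by (simp only: power_one_right of_real_mult mult_ac)
      ultimately show ?thesis by simp
    qed
    then have "(\<Sum>i\<le>k. ?a 1 i * ?a n (k - i)) =
        (\<Sum>i\<le>k. of_real (fps_nth p i * fps_nth (p ^ n) (k - i)) * cis (real k * \<theta>))"
      by (intro sum.cong refl) (simp only: atMost_iff)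
    also have "\<dots> = ?a (Suc n) k"
      by (simp only: power_Suc fps_mult_nth atLeast0AtMost sum_distrib_right of_real_sum)
    finally show "(\<Sum>i\<le>k. ?a 1 i * ?a n (k - i)) = ?a (Suc n) k" .
  qed
  finally show ?case .
qed

text \<open>
  Rotating \<open>chi \<theta>\<close> to the positive real axis writes \<open>1 - \<bar>chi \<theta>\<bar>\<close> as the sum of the non-negative
  terms \<open>p\<^sub>j (1 - cos (j \<theta> + \<alpha>))\<close>, so every single term is a lower bound.
\<close>

lemma cmod_chi_gap:
  obtains \<alpha> where "\<And>l. 2 * fps_nth p l * (sin ((real l * \<theta> + \<alpha>) / 2))\<^sup>2 \<le> 1 - cmod (chi \<theta>)"
proof -
  define \<alpha> where "\<alpha> = - Arg (chi \<theta>)"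
  have "cis \<alpha> * chi \<theta> = of_real (cmod (chi \<theta>))"
    unfolding \<alpha>_def by (subst (2) rcis_cmod_Arg[symmetric]) (simp add: rcis_def cis_mult mult.left_commute)
  then have "(\<lambda>j. cis \<alpha> * (of_real (fps_nth p j) * cis (real j * \<theta>))) sums of_real (cmod (chi \<theta>))"
    using sums_mult[OF chi_sums, of "cis \<alpha>" \<theta>] by simp
  from sums_Re[OF this]
  have "(\<lambda>j. fps_nth p j * cos (real j * \<theta> + \<alpha>)) sums cmod (chi \<theta>)"
    by (simp add: cos_add algebra_simps)
  from sums_diff[OF p_sums this]
  have s: "(\<lambda>j. fps_nth p j * (1 - cos (real j * \<theta> + \<alpha>))) sums (1 - cmod (chi \<theta>))"
    by (simp add: algebra_simps)
  show thesis
  proof (rule that[of \<alpha>])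
    fix l
    have "fps_nth p l * (1 - cos (real l * \<theta> + \<alpha>)) \<le> 1 - cmod (chi \<theta>)"
      by (rule term_le_of_sums_nonneg[OF s]) (intro mult_nonneg_nonneg nonneg, simp)
    moreover have "1 - cos (real l * \<theta> + \<alpha>) = 2 * (sin ((real l * \<theta> + \<alpha>) / 2))\<^sup>2"
      using cos_double_sin[of "(real l * \<theta> + \<alpha>) / 2"]
      by (simp only: nonzero_mult_div_cancel_left times_divide_eq_right)
    ultimately have "fps_nth p l * (2 * (sin ((real l * \<theta> + \<alpha>) / 2))\<^sup>2) \<le> 1 - cmod (chi \<theta>)"
      by (rule subst[rotated])
    then show "2 * fps_nth p l * (sin ((real l * \<theta> + \<alpha>) / 2))\<^sup>2 \<le> 1 - cmod (chi \<theta>)"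
      by linarith
  qed
qed

text \<open>
  If \<open>\<bar>chi \<theta>\<bar>\<close> is close to 1, then by \<open>cmod_chi_gap\<close> the angles \<open>l \<theta> + \<alpha>\<close> for the three indices
  \<open>l\<close> of the non-periodicity condition are all close to multiples of \<open>2 \<pi>\<close>. Hence so are
  \<open>(j - i) \<theta>\<close> and \<open>(k - i) \<theta>\<close>, and, by a Bezout combination of the two coprime differences, \<open>\<theta>\<close>
  itself. All estimates are linear in \<open>\<bar>sin\<bar>\<close> of the half angles, so \<open>1 - \<bar>chi \<theta>\<bar>\<close> is bounded below
  by a multiple of \<open>\<theta>\<^sup>2\<close>.
\<close>

lemma cmod_chi_decay:
  obtains \<delta> where "0 < \<delta>" "\<And>\<theta>. \<bar>\<theta>\<bar> \<le> pi \<Longrightarrow> cmod (chi \<theta>) \<le> exp (- (\<delta> * \<theta>\<^sup>2))"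
proof -
  obtain i j k where ijk: "0 < fps_nth p i" "0 < fps_nth p j" "0 < fps_nth p k"
    and gcd1: "gcd (int j - int i) (int k - int i) = 1"
    using nonperiodic unfolding nonperiodic_def by (elim exE conjE)
  obtain u v where uv: "u * (int j - int i) + v * (int k - int i) = 1"
    using bezout_int[of "int j - int i" "int k - int i"] unfolding gcd1 by blast
  define \<mu> where "\<mu> = Min {fps_nth p i, fps_nth p j, fps_nth p k}"
  have \<mu>: "0 < \<mu>" "\<mu> \<le> fps_nth p i" "\<mu> \<le> fps_nth p j" "\<mu> \<le> fps_nth p k"
    using ijk by (auto simp: \<mu>_def)
  \<comment> \<open>Each half-angle difference costs two of the quantities \<open>x l\<close> below, whence the factor 2.\<close>
  define K :: real where "K = 2 * (\<bar>of_int u\<bar> + \<bar>of_int v\<bar>)"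
  have K: "0 < K"
  proof -
    have "u \<noteq> 0 \<or> v \<noteq> 0" using uv by auto
    then show ?thesis by (auto simp: K_def)
  qed
  \<comment> \<open>\<open>8 = 16 / 2\<close>: the 16 is the square of the 4 in \<open>abs_sin_half_ge\<close>, the 2 comes from
    \<open>1 - cos y = 2 sin\<^sup>2 (y / 2)\<close>.\<close>
  define \<delta> where "\<delta> = \<mu> / (8 * K\<^sup>2)"
  show thesis
  proof (rule that[of \<delta>])
    show "0 < \<delta>" using \<mu> K by (simp add: \<delta>_def)
    fix \<theta> :: real assume \<theta>: "\<bar>\<theta>\<bar> \<le> pi"
    obtain \<alpha> where \<alpha>: "\<And>l. 2 * fps_nth p l * (sin ((real l * \<theta> + \<alpha>) / 2))\<^sup>2 \<le> 1 - cmod (chi \<theta>)"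
      using cmod_chi_gap by blast
    define x where "x l = \<bar>sin ((real l * \<theta> + \<alpha>) / 2)\<bar>" for l :: nat
    define r where "r = sqrt ((1 - cmod (chi \<theta>)) / (2 * \<mu>))"
    have x_le: "x l \<le> r" if "\<mu> \<le> fps_nth p l" for l
    proof -
      have "2 * \<mu> * (x l)\<^sup>2 \<le> 2 * fps_nth p l * (x l)\<^sup>2"
        using that by (intro mult_right_mono) auto
      also have "\<dots> \<le> 1 - cmod (chi \<theta>)" using \<alpha>[of l] by (simp add: x_def)
      finally have "(x l)\<^sup>2 \<le> (1 - cmod (chi \<theta>)) / (2 * \<mu>)"
        using \<mu> by (simp add: field_simps)
      then show ?thesis unfolding r_def by (rule real_le_rsqrt)
    qed
    have diff_le: "\<bar>sin (of_int (int l - int i) * (\<theta> / 2))\<bar> \<le> 2 * r" if "\<mu> \<le> fps_nth p l" for l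
    proof -
      have "of_int (int l - int i) * (\<theta> / 2) = (real l * \<theta> + \<alpha>) / 2 - (real i * \<theta> + \<alpha>) / 2"
        by (simp add: field_simps)
      then have "\<bar>sin (of_int (int l - int i) * (\<theta> / 2))\<bar> \<le> x l + x i"
        using abs_sin_diff_le[of "(real l * \<theta> + \<alpha>) / 2" "(real i * \<theta> + \<alpha>) / 2"]
        by (simp only: x_def)
      then show ?thesis using x_le[OF that] x_le[OF \<mu>(2)] by simp
    qed
    have "\<theta> / 2 = of_int (u * (int j - int i) + v * (int k - int i)) * (\<theta> / 2)"
      using uv by simp
    also have "\<dots> = of_int u * (of_int (int j - int i) * (\<theta> / 2)) + of_int v * (of_int (int k - int i) * (\<theta> / 2))"
      by (simp only: of_int_add of_int_mult distrib_right mult.assoc)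
    finally have "\<bar>sin (\<theta> / 2)\<bar> \<le> \<bar>sin (of_int u * (of_int (int j - int i) * (\<theta> / 2)))\<bar> +
        \<bar>sin (of_int v * (of_int (int k - int i) * (\<theta> / 2)))\<bar>"
      by (rule ord_eq_le_trans[OF arg_cong[of _ _ "\<lambda>x. \<bar>sin x\<bar>"] abs_sin_add_le])
    also have "\<dots> \<le> \<bar>of_int u\<bar> * (2 * r) + \<bar>of_int v\<bar> * (2 * r)"
      by (intro add_mono order_trans[OF abs_sin_int_mult_le] mult_left_mono diff_le \<mu>) auto
    also have "\<dots> = K * r" by (simp add: K_def algebra_simps)
    finally have "\<bar>\<theta>\<bar> / 4 \<le> K * r" using abs_sin_half_ge[OF \<theta>] by simp
    then have "(\<bar>\<theta>\<bar> / 4)\<^sup>2 \<le> (K * r)\<^sup>2" by (intro power_mono) auto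
    moreover have "r\<^sup>2 = (1 - cmod (chi \<theta>)) / (2 * \<mu>)"
    proof -
      have "0 \<le> 1 - cmod (chi \<theta>)"
        by (rule order_trans[OF _ \<alpha>[of 0]]) (use nonneg in auto)
      then show ?thesis using \<mu> by (simp add: r_def)
    qed
    ultimately have "\<theta>\<^sup>2 / 16 \<le> K\<^sup>2 * (1 - cmod (chi \<theta>)) / (2 * \<mu>)"
      by (simp add: power_mult_distrib power_divide)
    then have "\<delta> * \<theta>\<^sup>2 \<le> 1 - cmod (chi \<theta>)"
      using \<mu> K by (simp add: \<delta>_def field_simps)
    then show "cmod (chi \<theta>) \<le> exp (- (\<delta> * \<theta>\<^sup>2))"
      using exp_ge_add_one_self[of "- (\<delta> * \<theta>\<^sup>2)"] by linarith
  qed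
qed

text \<open>
  The characteristic function of the offspring number centred at its mean 1.
\<close>

definition psi :: "real \<Rightarrow> complex" where
  "psi \<theta> = chi \<theta> * cis (- \<theta>)"

lemma norm_psi [simp]: "norm (psi \<theta>) = norm (chi \<theta>)"
  by (simp add: psi_def norm_mult)

definition offspring_var :: real where
  "offspring_var = (\<Sum>j. (real j - 1)\<^sup>2 * fps_nth p j)"

lemma offspring_var_sums: "(\<lambda>j. (real j - 1)\<^sup>2 * fps_nth p j) sums offspring_var"
proof -
  have "(\<lambda>j. (real j - 1)\<^sup>2 * fps_nth p j) =
      (\<lambda>j. real j ^ 2 * fps_nth p j - 2 * (real j * fps_nth p j) + fps_nth p j)"
    by (auto simp: power2_eq_square algebra_simps)
  then show ?thesis
    unfolding offspring_var_def using moment_summable[of 2] mean_sums p_sums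
    by (intro summable_sums) (auto intro!: summable_add summable_diff summable_mult simp: sums_iff)
qed

lemma offspring_var_pos: "0 < offspring_var"
proof -
  have "(real 0 - 1)\<^sup>2 * fps_nth p 0 \<le> offspring_var"
    by (rule term_le_of_sums_nonneg[OF offspring_var_sums]) (intro mult_nonneg_nonneg nonneg, simp)
  then show ?thesis using p0_pos by simp
qed

text \<open>
  Second-order Taylor expansion of \<open>exp (i y)\<close> at \<open>y = (j - 1) \<theta>\<close>, summed over \<open>j\<close>: the linear
  term vanishes because the mean is 1, and the error is controlled by the third absolute moment.
\<close>

lemma psi_expansion:
  obtains K where "\<And>\<theta>. cmod (psi \<theta> - (1 - of_real (offspring_var * \<theta>\<^sup>2 / 2))) \<le> K * \<bar>\<theta>\<bar> ^ 3"
proof -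
  define c where "c j = \<bar>real j - 1\<bar> ^ 3 * fps_nth p j / 6" for j
  have "summable c"
  proof (rule summable_comparison_test_ev)
    show "summable (\<lambda>j. real j ^ 3 * fps_nth p j)" by (rule moment_summable)
    show "\<forall>\<^sub>F j in sequentially. norm (c j) \<le> real j ^ 3 * fps_nth p j"
      using eventually_ge_at_top[of 1]
    proof eventually_elim
      case (elim j)
      have "\<bar>real j - 1\<bar> ^ 3 \<le> real j ^ 3"
        by (rule power_mono) (use elim in auto)
      moreover have "0 \<le> real j ^ 3" by simp
      ultimately have "\<bar>real j - 1\<bar> ^ 3 / 6 \<le> real j ^ 3" by linarith
      then have "\<bar>real j - 1\<bar> ^ 3 / 6 * fps_nth p j \<le> real j ^ 3 * fps_nth p j"
        using nonneg by (intro mult_right_mono)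
      then show ?case using nonneg[of j] by (simp add: c_def)
    qed
  qed
  show thesis
  proof (rule that[of "suminf c"])
    fix \<theta> :: real
    define y where "y j = (real j - 1) * \<theta>" for j :: nat
    let ?t = "\<lambda>j. of_real (fps_nth p j) * (1 + \<i> * of_real (y j) - of_real ((y j)\<^sup>2 / 2))"
    have "(\<lambda>j. of_real (fps_nth p j) * cis (real j * \<theta>) * cis (- \<theta>)) sums psi \<theta>"
      unfolding psi_def by (intro sums_mult2 chi_sums)
    moreover have "(\<lambda>j. of_real (fps_nth p j) * cis (real j * \<theta>) * cis (- \<theta>)) =
        (\<lambda>j. of_real (fps_nth p j) * cis (y j))"
      by (auto simp: y_def cis_mult algebra_simps)
    ultimately have 1: "(\<lambda>j. of_real (fps_nth p j) * cis (y j)) sums psi \<theta>" by simp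
    have "(\<lambda>j. \<theta> * (real j * fps_nth p j - fps_nth p j)) sums (\<theta> * (1 - 1))"
      by (intro sums_mult sums_diff mean_sums p_sums)
    then have lin: "(\<lambda>j. fps_nth p j * y j) sums 0"
      by (simp add: y_def algebra_simps)
    have "(\<lambda>j. (\<theta>\<^sup>2 / 2) * ((real j - 1)\<^sup>2 * fps_nth p j)) sums ((\<theta>\<^sup>2 / 2) * offspring_var)"
      by (intro sums_mult offspring_var_sums)
    then have quad: "(\<lambda>j. fps_nth p j * (y j)\<^sup>2 / 2) sums (offspring_var * \<theta>\<^sup>2 / 2)"
      by (simp add: y_def power_mult_distrib mult_ac)
    have "(\<lambda>j. of_real (fps_nth p j) + \<i> * of_real (fps_nth p j * y j) - of_real (fps_nth p j * (y j)\<^sup>2 / 2))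
        sums (of_real 1 + \<i> * of_real 0 - of_real (offspring_var * \<theta>\<^sup>2 / 2) :: complex)"
      by (intro sums_add sums_diff sums_mult sums_of_real p_sums lin quad)
    then have 2: "?t sums (1 - of_real (offspring_var * \<theta>\<^sup>2 / 2))"
      by (simp add: algebra_simps)
    have 3: "(\<lambda>j. of_real (fps_nth p j) * cis (y j) - ?t j) sums (psi \<theta> - (1 - of_real (offspring_var * \<theta>\<^sup>2 / 2)))"
      by (rule sums_diff[OF 1 2])
    have le: "norm (of_real (fps_nth p j) * cis (y j) - ?t j) \<le> c j * \<bar>\<theta>\<bar> ^ 3" for j
    proof -
      have "cmod (cis (y j) - (1 + \<i> * of_real (y j) - of_real ((y j)\<^sup>2 / 2))) \<le> \<bar>y j\<bar> ^ 3 / 6"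
        using iexp_approx1[of "y j" 2]
        by (simp add: cis_conv_exp numeral_2_eq_2 numeral_3_eq_3 power2_eq_square algebra_simps)
      then have "fps_nth p j * cmod (cis (y j) - (1 + \<i> * of_real (y j) - of_real ((y j)\<^sup>2 / 2)))
          \<le> fps_nth p j * (\<bar>y j\<bar> ^ 3 / 6)"
        using nonneg by (intro mult_left_mono)
      moreover have "norm (of_real (fps_nth p j) * cis (y j) - ?t j) =
          fps_nth p j * cmod (cis (y j) - (1 + \<i> * of_real (y j) - of_real ((y j)\<^sup>2 / 2)))"
        unfolding right_diff_distrib[symmetric] norm_mult using nonneg[of j] by simp
      ultimately show ?thesis
        by (simp add: c_def y_def abs_mult power_mult_distrib mult_ac)
    qed
    have sc: "summable (\<lambda>j. c j * \<bar>\<theta>\<bar> ^ 3)" using \<open>summable c\<close> by (rule summable_mult2)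
    have "cmod (psi \<theta> - (1 - of_real (offspring_var * \<theta>\<^sup>2 / 2))) \<le> (\<Sum>j. c j * \<bar>\<theta>\<bar> ^ 3)"
      using norm_suminf_le[OF le sc] sums_unique[OF 3] by simp
    also have "\<dots> = suminf c * \<bar>\<theta>\<bar> ^ 3"
      using \<open>summable c\<close> by (simp add: suminf_mult2)
    finally show "cmod (psi \<theta> - (1 - of_real (offspring_var * \<theta>\<^sup>2 / 2))) \<le> suminf c * \<bar>\<theta>\<bar> ^ 3" .
  qed
qed

lemma norm_chi_le_1: "norm (chi \<theta>) \<le> 1"
proof -
  obtain \<alpha> where \<alpha>: "\<And>l. 2 * fps_nth p l * (sin ((real l * \<theta> + \<alpha>) / 2))\<^sup>2 \<le> 1 - cmod (chi \<theta>)"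
    using cmod_chi_gap by blast
  have "0 \<le> 2 * fps_nth p 0 * (sin ((real 0 * \<theta> + \<alpha>) / 2))\<^sup>2" using nonneg by auto
  then show ?thesis using \<alpha>[of 0] by linarith
qed

lemma psi_power_limit:
  "(\<lambda>n. psi (x / sqrt (real n)) ^ n) \<longlonglongrightarrow> of_real (exp (- (offspring_var / 2 * x\<^sup>2)))"
proof -
  obtain K where K: "\<And>\<theta>. cmod (psi \<theta> - (1 - of_real (offspring_var * \<theta>\<^sup>2 / 2))) \<le> K * \<bar>\<theta>\<bar> ^ 3"
    using psi_expansion by blast
  define u where "u = offspring_var / 2 * x\<^sup>2"
  have u: "0 \<le> u" using offspring_var_pos by (simp add: u_def)
  \<comment> \<open>Compare with the powers of the second-order approximation: replacing the base of an \<open>n\<close>-th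
    power inside the unit disc costs \<open>n\<close> times the error, here \<open>n (x / \<surd>n)\<^sup>3\<close>.\<close>
  have "(\<lambda>n. (1 + (- u) / real n) ^ n) \<longlonglongrightarrow> exp (- u)"
    by (rule tendsto_exp_limit_sequentially)
  then have "(\<lambda>n. complex_of_real ((1 + (- u) / real n) ^ n)) \<longlonglongrightarrow> of_real (exp (- u))"
    by (rule tendsto_of_real)
  moreover have "(\<lambda>n. psi (x / sqrt (real n)) ^ n - complex_of_real ((1 + (- u) / real n) ^ n)) \<longlonglongrightarrow> 0"
  proof (rule Lim_null_comparison)
    show "(\<lambda>n. K * \<bar>x\<bar> ^ 3 / sqrt (real n)) \<longlonglongrightarrow> 0"
      by real_asymp
    show "\<forall>\<^sub>F n in sequentially.
        norm (psi (x / sqrt (real n)) ^ n - complex_of_real ((1 + (- u) / real n) ^ n)) \<le> K * \<bar>x\<bar> ^ 3 / sqrt (real n)"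
      using eventually_gt_at_top[of "nat \<lceil>u\<rceil>"] eventually_gt_at_top[of 0]
    proof eventually_elim
      case (elim n)
      have un: "u \<le> real n" using elim(1) by linarith
      let ?b = "1 - of_real (u / real n) :: complex"
      have "norm ?b = \<bar>1 - u / real n\<bar>"
        by (metis norm_of_real of_real_1 of_real_diff)
      also have "\<dots> \<le> 1" using u un elim by (auto simp: abs_le_iff field_simps)
      finally have b: "norm ?b \<le> 1" .
      have "offspring_var * (x / sqrt (real n))\<^sup>2 / 2 = u / real n"
        by (simp add: u_def power_divide)
      then have "norm (psi (x / sqrt (real n)) - ?b) \<le> K * \<bar>x / sqrt (real n)\<bar> ^ 3"
        using K[of "x / sqrt (real n)"] by (simp only:)
      then have "real n * norm (psi (x / sqrt (real n)) - ?b) \<le> real n * (K * \<bar>x / sqrt (real n)\<bar> ^ 3)"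
        by (rule mult_left_mono) simp
      moreover have "norm (psi (x / sqrt (real n)) ^ n - ?b ^ n) \<le> real n * norm (psi (x / sqrt (real n)) - ?b)"
        by (intro norm_power_diff b) (simp add: norm_chi_le_1)
      ultimately have "norm (psi (x / sqrt (real n)) ^ n - ?b ^ n) \<le> real n * (K * \<bar>x / sqrt (real n)\<bar> ^ 3)"
        by linarith
      also have "\<dots> = K * \<bar>x\<bar> ^ 3 / sqrt (real n)"
        using elim by (simp add: power_divide power3_eq_cube)
      finally show ?case by simp
    qed
  qed
  ultimately have "(\<lambda>n. (psi (x / sqrt (real n)) ^ n - complex_of_real ((1 + (- u) / real n) ^ n)) +
      complex_of_real ((1 + (- u) / real n) ^ n)) \<longlonglongrightarrow> 0 + of_real (exp (- u))"
    by (intro tendsto_add)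
  then show ?thesis by (simp add: u_def)
qed

text \<open>
  The Fourier integrand for \<open>[u\<^sup>n\<^sup>-\<^sup>m] p\<^sup>n\<close> after the substitution \<open>\<theta> = x / \<surd>n\<close>. Centring absorbs the
  large frequency \<open>n\<close>, so that only the phase \<open>m \<theta>\<close> remains.
\<close>

definition scaled_integrand :: "nat \<Rightarrow> nat \<Rightarrow> real \<Rightarrow> complex" where
  "scaled_integrand m n x = indicator {-pi..pi} (x / sqrt (real n)) *\<^sub>R
     (psi (x / sqrt (real n)) ^ n * cis (real m * (x / sqrt (real n))))"

lemma power_coeff_integral:
  assumes "0 < n" "m \<le> n"
  shows "has_bochner_integral lborel (scaled_integrand m n)
    (of_real (2 * pi * (sqrt (real n) * fps_nth (p ^ n) (n - m))))"
proof -
  have s: "summable (fps_nth (p ^ n))"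
    using fps_power_sums[OF nonneg, of n] p_sums by (simp add: sums_iff)
  let ?f = "\<lambda>\<theta>. indicator {-pi..pi} \<theta> *\<^sub>R (psi \<theta> ^ n * cis (real m * \<theta>))"
  have "chi \<theta> ^ n * cis (- (real (n - m) * \<theta>)) = psi \<theta> ^ n * cis (real m * \<theta>)" for \<theta>
  proof -
    have "psi \<theta> ^ n * cis (real m * \<theta>) = chi \<theta> ^ n * (cis (real n * - \<theta>) * cis (real m * \<theta>))"
      by (simp only: psi_def power_mult_distrib Complex.DeMoivre mult.assoc)
    also have "cis (real n * - \<theta>) * cis (real m * \<theta>) = cis (- (real (n - m) * \<theta>))"
      using assms(2) by (simp add: cis_mult of_nat_diff algebra_simps)
    finally show ?thesis ..
  qed
  then have hb: "has_bochner_integral lborel ?f (of_real (2 * pi * fps_nth (p ^ n) (n - m)))"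
    using fourier_coefficient[OF fps_nth_power_nonneg[OF nonneg] s, of "n - m"]
    by (simp add: sums_unique[OF chi_power_sums, symmetric])
  have c: "1 / sqrt (real n) \<noteq> 0" using assms by simp
  from lborel_integral_real_affine[OF c, of ?f 0] lborel_integrable_real_affine_iff[OF c, of ?f 0] hb
  show ?thesis using assms
    by (simp add: has_bochner_integral_iff scaled_integrand_def[abs_def] scaleR_conv_of_real field_simps)
qed

lemma scaled_integrand_bound:
  obtains \<delta> where "0 < \<delta>" "\<And>n m x. 0 < n \<Longrightarrow> norm (scaled_integrand m n x) \<le> exp (- (\<delta> * x\<^sup>2))"
proof -
  obtain \<delta> where \<delta>: "0 < \<delta>" "\<And>\<theta>. \<bar>\<theta>\<bar> \<le> pi \<Longrightarrow> cmod (chi \<theta>) \<le> exp (- (\<delta> * \<theta>\<^sup>2))"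
    using cmod_chi_decay by blast
  show thesis
  proof (rule that[OF \<delta>(1)])
    fix n m :: nat and x :: real assume n: "0 < n"
    show "norm (scaled_integrand m n x) \<le> exp (- (\<delta> * x\<^sup>2))"
    proof (cases "\<bar>x / sqrt (real n)\<bar> \<le> pi")
      case True
      have "norm (scaled_integrand m n x) \<le> cmod (chi (x / sqrt (real n))) ^ n"
        by (simp add: scaled_integrand_def norm_mult norm_power indicator_def)
      also have "\<dots> \<le> exp (- (\<delta> * (x / sqrt (real n))\<^sup>2)) ^ n"
        by (intro power_mono \<delta>(2) True) auto
      also have "\<dots> = exp (- (\<delta> * x\<^sup>2))"
        using n by (simp add: power_divide flip: exp_of_nat_mult)
      finally show ?thesis .
    next
      case False
      then have "x / sqrt (real n) \<notin> {-pi..pi}" by (auto simp: abs_le_iff)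
      then show ?thesis by (simp add: scaled_integrand_def)
    qed
  qed
qed

text \<open>
  The integrand has the Gaussian majorant \<open>scaled_integrand_bound\<close>, which depends on neither
  \<open>n\<close> nor \<open>m\<close>.
\<close>

theorem local_limit_bound:
  obtains C where "\<And>n m. 0 < n \<Longrightarrow> m \<le> n \<Longrightarrow> sqrt (real n) * fps_nth (p ^ n) (n - m) \<le> C"
proof -
  obtain \<delta> where \<delta>: "0 < \<delta>" "\<And>n m x. 0 < n \<Longrightarrow> norm (scaled_integrand m n x) \<le> exp (- (\<delta> * x\<^sup>2))"
    using scaled_integrand_bound by blast
  show thesis
  proof (rule that[of "sqrt (pi / \<delta>) / (2 * pi)"])
    fix n m :: nat assume nm: "0 < n" "m \<le> n"
    let ?q = "sqrt (real n) * fps_nth (p ^ n) (n - m)"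
    note G = has_bochner_integral_gaussian[OF \<delta>(1)]
    note I = power_coeff_integral[OF nm]
    have "2 * pi * ?q \<le> norm (complex_of_real (2 * pi * ?q))"
      unfolding norm_of_real by (rule abs_ge_self)
    also have "complex_of_real (2 * pi * ?q) = integral\<^sup>L lborel (scaled_integrand m n)"
      using I by (rule has_bochner_integral_integral_eq[symmetric])
    also have "norm \<dots> \<le> (LINT x|lborel. norm (scaled_integrand m n x))"
      by (rule integral_norm_bound)
    also have "\<dots> \<le> (LINT x|lborel. exp (- (\<delta> * x\<^sup>2)))"
      using I G \<delta>(2)[OF nm(1)] by (intro integral_mono) (auto simp: has_bochner_integral_iff)
    also have "\<dots> = sqrt (pi / \<delta>)"
      using G by (rule has_bochner_integral_integral_eq)
    finally show "?q \<le> sqrt (pi / \<delta>) / (2 * pi)" by (simp add: field_simps)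
  qed
qed

text \<open>
  Dominated convergence: the integrands tend to a Gaussian function, whose integral is positive.
\<close>

theorem local_limit:
  obtains c where "0 < c" "(\<lambda>n. sqrt (real n) * fps_nth (p ^ n) (n - 1)) \<longlonglongrightarrow> c"
proof -
  obtain \<delta> where \<delta>: "0 < \<delta>" "\<And>n m x. 0 < n \<Longrightarrow> norm (scaled_integrand m n x) \<le> exp (- (\<delta> * x\<^sup>2))"
    using scaled_integrand_bound by blast
  define c where "c = sqrt (pi / (offspring_var / 2))"
  have c: "0 < c" using offspring_var_pos by (simp add: c_def)
  have G: "has_bochner_integral lborel (\<lambda>x. of_real (exp (- (offspring_var / 2 * x\<^sup>2)))) (complex_of_real c)"
    unfolding c_def by (intro has_bochner_integral_of_real has_bochner_integral_gaussian) (simp add: offspring_var_pos)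
  let ?q = "\<lambda>n. sqrt (real n) * fps_nth (p ^ n) (n - 1)"
  have lim: "(\<lambda>n. integral\<^sup>L lborel (scaled_integrand 1 (Suc n))) \<longlonglongrightarrow>
      (LINT x|lborel. of_real (exp (- (offspring_var / 2 * x\<^sup>2))))"
  proof (rule integral_dominated_convergence)
    show "integrable lborel (\<lambda>x. exp (- (\<delta> * x\<^sup>2)))"
      using has_bochner_integral_gaussian[OF \<delta>(1)] by (simp add: has_bochner_integral_iff)
    show "AE x in lborel. norm (scaled_integrand 1 (Suc n) x) \<le> exp (- (\<delta> * x\<^sup>2))" for n
      using \<delta>(2) by simp
    show "scaled_integrand 1 (Suc n) \<in> borel_measurable lborel" for n
      using power_coeff_integral[of "Suc n" 1]
      by (auto simp: has_bochner_integral_iff)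
    show "(\<lambda>x. complex_of_real (exp (- (offspring_var / 2 * x\<^sup>2)))) \<in> borel_measurable lborel"
      using G by (auto simp: has_bochner_integral_iff)
    show "AE x in lborel. (\<lambda>n. scaled_integrand 1 (Suc n) x) \<longlonglongrightarrow> of_real (exp (- (offspring_var / 2 * x\<^sup>2)))"
    proof (rule AE_I2)
      fix x :: real
      have x0: "(\<lambda>n. x / sqrt (real n)) \<longlonglongrightarrow> 0" by real_asymp
      have "(\<lambda>n. psi (x / sqrt (real n)) ^ n * cis (real 1 * (x / sqrt (real n)))) \<longlonglongrightarrow>
          of_real (exp (- (offspring_var / 2 * x\<^sup>2))) * cis (real 1 * 0)"
        by (intro tendsto_intros psi_power_limit x0)
      then have "(\<lambda>n. psi (x / sqrt (real n)) ^ n * cis (real 1 * (x / sqrt (real n)))) \<longlonglongrightarrow>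
          of_real (exp (- (offspring_var / 2 * x\<^sup>2)))" by simp
      moreover have "\<forall>\<^sub>F n in sequentially.
          psi (x / sqrt (real n)) ^ n * cis (real 1 * (x / sqrt (real n))) = scaled_integrand 1 n x"
      proof -
        have "\<forall>\<^sub>F n in sequentially. \<bar>x / sqrt (real n)\<bar> < pi"
          using tendsto_rabs[OF x0] by (rule order_tendstoD(2)) simp
        then show ?thesis
          by eventually_elim (auto simp: scaled_integrand_def indicator_def abs_if split: if_splits)
      qed
      ultimately have "(\<lambda>n. scaled_integrand 1 n x) \<longlonglongrightarrow> of_real (exp (- (offspring_var / 2 * x\<^sup>2)))"
        by (rule Lim_transform_eventually)
      then show "(\<lambda>n. scaled_integrand 1 (Suc n) x) \<longlonglongrightarrow> of_real (exp (- (offspring_var / 2 * x\<^sup>2)))"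
        by (rule LIMSEQ_Suc)
    qed
  qed
  moreover have "integral\<^sup>L lborel (scaled_integrand 1 (Suc n)) = of_real (2 * pi * ?q (Suc n))" for n
    using power_coeff_integral[of "Suc n" 1]
    by (intro has_bochner_integral_integral_eq) auto
  moreover have "(LINT x|lborel. of_real (exp (- (offspring_var / 2 * x\<^sup>2)))) = complex_of_real c"
    using G by (rule has_bochner_integral_integral_eq)
  ultimately have "(\<lambda>n. complex_of_real (2 * pi * ?q (Suc n))) \<longlonglongrightarrow> of_real c"
    by simp
  then have "(\<lambda>n. 2 * pi * ?q (Suc n)) \<longlonglongrightarrow> c"
    by (simp only: tendsto_of_real_iff)
  then have "(\<lambda>n. 2 * pi * ?q n) \<longlonglongrightarrow> c"
    by (rule LIMSEQ_imp_Suc)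
  then have "(\<lambda>n. 2 * pi * ?q n / (2 * pi)) \<longlonglongrightarrow> c / (2 * pi)"
    by (intro tendsto_divide) auto
  then show thesis using that[of "c / (2 * pi)"] c by simp
qed
end

section \<open>Generating functions of critical family trees\<close>

text \<open>
  The strict version of Bernoulli's inequality that excludes a second fixed point in \<open>tree_total\<close>.
\<close>

lemma one_minus_power_less:
  fixes A :: real
  assumes "0 \<le> A" "A < 1" "2 \<le> j"
  shows "1 - A ^ j < real j * (1 - A)"
proof -
  obtain k where k: "j = Suc k" "1 \<le> k" using assms(3) by (cases j) auto
  have "1 + real k * (A - 1) \<le> A ^ k"
    using Bernoulli_inequality[of "A - 1" k] assms by simp
  then have "A * (1 + real k * (A - 1)) \<le> A ^ j"
    using assms k by (simp add: mult_left_mono)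
  moreover have "0 < real k * (1 - A)\<^sup>2" using assms k by simp
  moreover have "A * (1 + real k * (A - 1)) = 1 - real j * (1 - A) + real k * (1 - A)\<^sup>2"
    using k by (simp add: algebra_simps power2_eq_square)
  ultimately show ?thesis by linarith
qed

lemma protection_less_nodes: "protection t < nodes t"
proof (induction t)
  case (Node ts)
  show ?case
  proof (cases "protection (Node ts)")
    case (Suc k)
    then have "ts \<noteq> []" "\<forall>t\<in>set ts. k \<le> protection t"
      using Suc_le_protection_iff[of k ts] by auto
    then obtain t where t: "t \<in> set ts" "k \<le> protection t" by (cases ts) auto
    have "nodes t \<le> sum_list (map nodes ts)"
      using t(1) by (intro member_le_sum_list) auto
    then show ?thesis using Suc t Node[OF t(1)] by simp
  qed simp
qed

lemma prot_gf_nonneg: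
  assumes "\<And>j. fps_nth \<phi> j \<ge> 0"
  shows "0 \<le> fps_nth (prot_gf \<phi> k) n"
  by (simp add: prot_gf_def sum_nonneg weight_nonneg assms)

lemma prot_gf_le_tree_gf:
  assumes "\<And>j. fps_nth \<phi> j \<ge> 0"
  shows "fps_nth (prot_gf \<phi> k) n \<le> fps_nth (tree_gf \<phi>) n"
  unfolding prot_gf_def tree_gf_def fps_nth_Abs_fps
  by (intro sum_mono2 finite_nodes_eq weight_nonneg assms) auto

lemma prot_gf_nth_eq_0:
  assumes "n \<le> k"
  shows "fps_nth (prot_gf \<phi> k) n = 0"
proof -
  have "\<not> (nodes t = n \<and> k \<le> protection t)" for t
    using protection_less_nodes[of t] assms by linarith
  then have "{t. nodes t = n \<and> k \<le> protection t} = {}"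
    by blast
  then show ?thesis unfolding prot_gf_def fps_nth_Abs_fps by (metis sum.empty)
qed

lemma prot_gf_Suc_nth_sums:
  "(\<lambda>m. fps_nth \<phi> (Suc m) * fps_nth (prot_gf \<phi> k ^ Suc m) n) sums fps_nth (prot_gf \<phi> (Suc k)) (Suc n)"
proof -
  let ?f = "\<lambda>m. fps_nth \<phi> m * fps_nth (prot_gf \<phi> k ^ m) n"
  have "fps_nth (prot_gf \<phi> k) 0 = 0" by (rule prot_gf_nth_eq_0) simp
  then have "?f sums (\<Sum>m\<in>{0..n}. ?f m)"
    by (intro sums_finite) (auto simp: startsby_zero_power_prefix)
  then have "?f sums fps_nth (fps_compose \<phi> (prot_gf \<phi> k)) n"
    by (simp add: fps_compose_nth)
  moreover have "?f 0 = fps_nth (fps_const (fps_nth \<phi> 0)) n" by simp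
  ultimately have "(\<lambda>m. ?f (Suc m)) sums
      (fps_nth (fps_compose \<phi> (prot_gf \<phi> k)) n - fps_nth (fps_const (fps_nth \<phi> 0)) n)"
    by (subst sums_Suc_iff) simp
  then show ?thesis by (simp add: prot_gf_Suc)
qed

context critical_offspring
begin

lemma tree_gf_nonneg: "0 \<le> fps_nth (tree_gf p) n"
  using prot_gf_nonneg[OF nonneg, of 0 n] by (simp add: prot_gf_0)

lemma tree_gf_nth_0: "fps_nth (tree_gf p) 0 = 0"
  by (subst tree_gf_eq) simp

lemma pow32_tree_power:
  assumes "0 < n"
  shows "pow32 n * fps_nth (tree_gf p ^ m) n =
    real m * (if m \<le> n then sqrt (real n) * fps_nth (p ^ n) (n - m) else 0)"
  using otter_dwass[OF tree_gf_eq[of p], where n = n and m = m] by (auto simp: pow32_def mult_ac)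

text \<open>
  The growth of the bound is only linear in \<open>m\<close>. It dominates the series over the root degree \<open>m\<close>
  in \<open>prot_limit\<close> and limits the total mass in \<open>tree_total_le_1\<close>.
\<close>

lemma tree_power_bound:
  obtains C where "0 \<le> C" "\<And>m n. pow32 n * fps_nth (tree_gf p ^ m) n \<le> C * real m"
proof -
  obtain C where C: "\<And>n m. 0 < n \<Longrightarrow> m \<le> n \<Longrightarrow> sqrt (real n) * fps_nth (p ^ n) (n - m) \<le> C"
    using local_limit_bound by blast
  have "0 \<le> sqrt (real 1) * fps_nth (p ^ 1) (1 - 1)" using nonneg by simp
  also have "\<dots> \<le> C" by (rule C) auto
  finally have C0: "0 \<le> C" .
  show thesis
  proof (rule that[OF C0])
    fix m n
    show "pow32 n * fps_nth (tree_gf p ^ m) n \<le> C * real m"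
    proof (cases "n = 0")
      case True
      then show ?thesis using C0 by (simp add: pow32_def)
    next
      case False
      then show ?thesis using C[of n m] C0 mult_left_mono[of _ C "real m"]
        by (auto simp: pow32_tree_power mult.commute[of C])
    qed
  qed
qed

lemma tree_limit:
  obtains c where "0 < c" "(\<lambda>n. pow32 n * fps_nth (tree_gf p) n) \<longlonglongrightarrow> c"
proof -
  obtain c where c: "0 < c" "(\<lambda>n. sqrt (real n) * fps_nth (p ^ n) (n - 1)) \<longlonglongrightarrow> c"
    using local_limit by blast
  have "\<forall>\<^sub>F n in sequentially. sqrt (real n) * fps_nth (p ^ n) (n - 1) = pow32 n * fps_nth (tree_gf p) n"
    using eventually_gt_at_top[of 0] by eventually_elim (use pow32_tree_power[of _ 1] in simp)
  then show thesis using that[OF c(1)] c(2) by (blast intro: Lim_transform_eventually)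
qed

lemma tree_summable: "summable (fps_nth (tree_gf p))"
proof -
  obtain C where "\<And>m n. pow32 n * fps_nth (tree_gf p ^ m) n \<le> C * real m"
    using tree_power_bound by blast
  from this[of _ 1] show ?thesis
    by (intro summable_of_pow32_bounded[of _ C] tree_gf_nonneg) simp
qed

text \<open>
  By \<open>tree_power_bound\<close> the powers \<open>A\<^sup>m\<close> of the total mass grow at most linearly.
\<close>

lemma tree_total_le_1: "suminf (fps_nth (tree_gf p)) \<le> 1"
proof (rule ccontr)
  let ?A = "suminf (fps_nth (tree_gf p))"
  assume "\<not> ?A \<le> 1"
  then have A: "1 < ?A" by simp
  obtain C where C: "0 \<le> C" "\<And>m n. pow32 n * fps_nth (tree_gf p ^ m) n \<le> C * real m"
    using tree_power_bound by blast
  have s: "summable (\<lambda>n. 1 / pow32 n)"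
  proof (rule summable_of_pow32_bounded)
    show "pow32 n * (1 / pow32 n) \<le> 1" for n by simp
  qed simp
  have "?A ^ Suc m \<le> C * suminf (\<lambda>n. 1 / pow32 n) * real (Suc m)" for m
  proof -
    have "fps_nth (tree_gf p ^ Suc m) n \<le> C * real (Suc m) * (1 / pow32 n)" for n
    proof (cases "n = 0")
      case True
      then show ?thesis using C(1) by (simp add: tree_gf_nth_0)
    next
      case False
      then show ?thesis using C(2)[of n "Suc m"] pow32_pos[of n] by (simp add: field_simps)
    qed
    moreover have "fps_nth (tree_gf p ^ Suc m) sums ?A ^ Suc m"
      by (rule fps_power_sums[OF tree_gf_nonneg tree_summable])
    ultimately have "?A ^ Suc m \<le> (\<Sum>n. C * real (Suc m) * (1 / pow32 n))"
      using s by (intro sums_le[OF _ _ summable_sums[OF summable_mult]]) auto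
    also have "\<dots> = C * real (Suc m) * suminf (\<lambda>n. 1 / pow32 n)"
      by (rule suminf_mult[OF s])
    finally show ?thesis by (simp only: mult_ac)
  qed
  then have le: "1 \<le> C * suminf (\<lambda>n. 1 / pow32 n) * (real (Suc m) * (1 / ?A) ^ Suc m)" for m
    using A by (simp add: field_simps)
  have "(\<lambda>m. real m * (1 / ?A) ^ m) \<longlonglongrightarrow> 0"
    using A by (intro powser_times_n_limit_0) simp
  then have "(\<lambda>m. C * suminf (\<lambda>n. 1 / pow32 n) * (real (Suc m) * (1 / ?A) ^ Suc m)) \<longlonglongrightarrow>
      C * suminf (\<lambda>n. 1 / pow32 n) * 0"
    by (intro tendsto_mult_left LIMSEQ_Suc)
  then have "(1 :: real) \<le> C * suminf (\<lambda>n. 1 / pow32 n) * 0"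
    by (rule LIMSEQ_le_const) (use le in blast)
  then show False by simp
qed

lemma p_power_summable:
  assumes "0 \<le> x" "x \<le> 1"
  shows "summable (\<lambda>m. fps_nth p m * x ^ m)"
proof (rule summable_comparison_test)
  show "\<exists>N. \<forall>m\<ge>N. norm (fps_nth p m * x ^ m) \<le> fps_nth p m"
    using assms nonneg by (auto simp: abs_mult mult_left_le power_le_one)
qed (use p_sums in \<open>simp add: sums_iff\<close>)

text \<open>
  A critical branching process dies out almost surely: \<open>A\<close> is a fixed point of \<open>p\<close> in \<open>[0, 1]\<close>,
  and the graph of the strictly convex \<open>p\<close> touches the diagonal at 1, so there is no other one.
\<close>

lemma tree_total: "suminf (fps_nth (tree_gf p)) = 1"
proof (rule ccontr)
  let ?A = "suminf (fps_nth (tree_gf p))"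
  assume "?A \<noteq> 1"
  then have A: "0 \<le> ?A" "?A < 1"
    using tree_total_le_1 tree_gf_nonneg tree_summable by (auto simp: suminf_nonneg)
  let ?S = "\<Sum>m. fps_nth p m * ?A ^ m"
  have S: "(\<lambda>m. fps_nth p m * ?A ^ m) sums ?S"
    using p_power_summable[of ?A] A by (simp add: summable_sums)
  then have "fps_nth (fps_compose p (tree_gf p)) sums ?S"
    by (intro fps_compose_sums nonneg tree_gf_nonneg tree_gf_nth_0 tree_summable)
  moreover have "fps_nth (fps_compose p (tree_gf p)) = (\<lambda>n. fps_nth (tree_gf p) (Suc n))"
    by (rule ext, subst (2) tree_gf_eq) simp
  ultimately have "(\<lambda>n. fps_nth (tree_gf p) (Suc n)) sums ?S" by simp
  then have "fps_nth (tree_gf p) sums ?S"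
    by (subst (asm) sums_Suc_iff) (simp add: tree_gf_nth_0)
  then have "?S = ?A" by (rule sums_unique)
  have "(\<lambda>m. (1 - ?A) * (real m * fps_nth p m) - (fps_nth p m - fps_nth p m * ?A ^ m)) sums
      ((1 - ?A) * 1 - (1 - ?S))"
    by (intro sums_diff sums_mult mean_sums p_sums S)
  then have sums0: "(\<lambda>m. fps_nth p m * (real m * (1 - ?A) - (1 - ?A ^ m))) sums 0"
    unfolding \<open>?S = ?A\<close> by (simp add: algebra_simps)
  have ge: "0 \<le> fps_nth p m * (real m * (1 - ?A) - (1 - ?A ^ m))" for m
    using nonneg[of m] one_minus_power_less[OF A, of m]
    by (cases "2 \<le> m") (auto simp: not_le less_2_cases_iff)
  obtain j where j: "2 \<le> j" "0 < fps_nth p j" using branching by blast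
  then have "0 < fps_nth p j * (real j * (1 - ?A) - (1 - ?A ^ j))"
    using one_minus_power_less[OF A, of j] by simp
  with term_le_of_sums_nonneg[OF sums0 ge, of j] show False by simp
qed

text \<open>
  The value \<open>T\<^sub>k(1)\<close>.
\<close>

definition prot_mass :: "nat \<Rightarrow> real" where
  "prot_mass k = suminf (fps_nth (prot_gf p k))"

lemma prot_summable: "summable (fps_nth (prot_gf p k))"
  by (rule summable_comparison_test[OF _ tree_summable])
     (auto intro!: exI[of _ 0] simp: prot_gf_nonneg[OF nonneg] prot_gf_le_tree_gf[OF nonneg])

lemma prot_mass_0: "prot_mass 0 = 1"
  by (simp add: prot_mass_def prot_gf_0 tree_total)

lemma prot_mass_nonneg: "0 \<le> prot_mass k"
  unfolding prot_mass_def by (intro suminf_nonneg prot_summable prot_gf_nonneg nonneg)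

lemma prot_mass_le_1: "prot_mass k \<le> 1"
  unfolding prot_mass_def tree_total[symmetric]
  by (intro suminf_le prot_summable tree_summable prot_gf_le_tree_gf nonneg)

text \<open>
  \<open>T\<^sub>k\<^sub>+\<^sub>1(1) = p(T\<^sub>k(1)) - p\<^sub>0\<close>, and \<open>x\<^sup>m \<le> x\<close> on \<open>[0, 1]\<close> for \<open>m \<ge> 1\<close>.
\<close>

lemma prot_mass_Suc_le: "prot_mass (Suc k) \<le> (1 - fps_nth p 0) * prot_mass k"
proof -
  have s: "(\<lambda>m. fps_nth p m * prot_mass k ^ m) sums (\<Sum>m. fps_nth p m * prot_mass k ^ m)"
    by (intro summable_sums p_power_summable prot_mass_nonneg prot_mass_le_1)
  have z: "fps_nth (prot_gf p k) 0 = 0" for k by (rule prot_gf_nth_eq_0) simp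
  have "fps_nth (fps_compose p (prot_gf p k)) sums (\<Sum>m. fps_nth p m * prot_mass k ^ m)"
    using s unfolding prot_mass_def
    by (intro fps_compose_sums nonneg prot_gf_nonneg z prot_summable)
  moreover have "fps_nth (fps_const (fps_nth p 0)) sums fps_nth p 0"
  proof -
    have "fps_nth (fps_const (fps_nth p 0)) = (\<lambda>n. if n = 0 then fps_nth p 0 else 0)"
      by (simp add: fun_eq_iff)
    then show ?thesis using sums_single[of 0 "\<lambda>_. fps_nth p 0"] by simp
  qed
  ultimately have "(\<lambda>n. fps_nth (fps_compose p (prot_gf p k)) n - fps_nth (fps_const (fps_nth p 0)) n) sums
      ((\<Sum>m. fps_nth p m * prot_mass k ^ m) - fps_nth p 0)"
    by (rule sums_diff)
  moreover have "fps_nth (prot_gf p (Suc k)) (Suc n) =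
      fps_nth (fps_compose p (prot_gf p k)) n - fps_nth (fps_const (fps_nth p 0)) n" for n
    by (simp add: prot_gf_Suc)
  ultimately have "(\<lambda>n. fps_nth (prot_gf p (Suc k)) (Suc n)) sums ((\<Sum>m. fps_nth p m * prot_mass k ^ m) - fps_nth p 0)"
    by simp
  then have "fps_nth (prot_gf p (Suc k)) sums ((\<Sum>m. fps_nth p m * prot_mass k ^ m) - fps_nth p 0)"
    by (subst (asm) sums_Suc_iff) (simp add: z)
  then have "prot_mass (Suc k) = (\<Sum>m. fps_nth p m * prot_mass k ^ m) - fps_nth p 0"
    unfolding prot_mass_def by (rule sums_unique[symmetric])
  moreover have "(\<lambda>m. fps_nth p (Suc m) * prot_mass k ^ Suc m) sums ((\<Sum>m. fps_nth p m * prot_mass k ^ m) - fps_nth p 0)"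
    using s by (subst sums_Suc_iff) simp
  ultimately have "(\<lambda>m. fps_nth p (Suc m) * prot_mass k ^ Suc m) sums prot_mass (Suc k)" by simp
  moreover have "(\<lambda>m. fps_nth p (Suc m) * prot_mass k) sums ((1 - fps_nth p 0) * prot_mass k)"
    using p_sums by (intro sums_mult2) (subst sums_Suc_iff, simp)
  moreover have "fps_nth p (Suc m) * prot_mass k ^ Suc m \<le> fps_nth p (Suc m) * prot_mass k" for m
    using prot_mass_nonneg[of k] prot_mass_le_1[of k]
    by (intro mult_left_mono nonneg) (simp add: mult_left_le power_le_one)
  ultimately show ?thesis by (rule sums_le[rotated])
qed

lemma prot_mass_tendsto_0: "prot_mass \<longlonglongrightarrow> 0"
proof (rule tendsto_sandwich[of "\<lambda>_. 0"])
  have p0: "fps_nth p 0 \<le> 1" by (rule term_le_of_sums_nonneg[OF p_sums nonneg])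
  have "prot_mass k \<le> (1 - fps_nth p 0) ^ k" for k
  proof (induction k)
    case (Suc k)
    have "prot_mass (Suc k) \<le> (1 - fps_nth p 0) * prot_mass k" by (rule prot_mass_Suc_le)
    also have "\<dots> \<le> (1 - fps_nth p 0) * (1 - fps_nth p 0) ^ k"
      using Suc p0 by (intro mult_left_mono) auto
    finally show ?case by simp
  qed (simp add: prot_mass_0)
  then show "\<forall>\<^sub>F k in sequentially. prot_mass k \<le> (1 - fps_nth p 0) ^ k" by simp
  show "(\<lambda>k. (1 - fps_nth p 0) ^ k) \<longlonglongrightarrow> 0"
    using p0 p0_pos by (intro LIMSEQ_power_zero) auto
qed (auto simp: prot_mass_nonneg)

text \<open>
  The limit of the probability that the protection number is at least \<open>k\<close>. The factor for
  \<open>i = 0\<close> equals 1; it is kept here so that the recursion in \<open>k\<close> holds from the start.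
\<close>

definition tail_limit :: "nat \<Rightarrow> real" where
  "tail_limit k = (\<Prod>i<k. eval_fps (fps_deriv p) (prot_mass i))"

lemma deriv_sums:
  assumes "0 \<le> x" "x \<le> 1"
  shows "(\<lambda>m. fps_nth (fps_deriv p) m * x ^ m) sums eval_fps (fps_deriv p) x"
proof (rule sums_eval_fps)
  have "ereal (norm x) \<le> 1" using assms by (simp add: one_ereal_def)
  also have "1 < fps_conv_radius (fps_deriv p)"
    using radius fps_conv_radius_deriv[of p] by (rule order_less_le_trans)
  finally show "ereal (norm x) < fps_conv_radius (fps_deriv p)" .
qed

lemma deriv_nonneg:
  assumes "0 \<le> x" "x \<le> 1"
  shows "0 \<le> eval_fps (fps_deriv p) x"
  by (rule sums_le[OF _ sums_zero deriv_sums[OF assms]]) (use assms nonneg in auto)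

text \<open>
  Apply \<open>fps_power_limit\<close> to each power of \<open>T\<^sub>k\<close> in the recursion for \<open>T\<^sub>k\<^sub>+\<^sub>1\<close>. The coefficients of
  \<open>T\<^sub>k\<^sup>m\<close> are at most those of \<open>T\<^sup>m\<close>, so \<open>tree_power_bound\<close> and the finite mean of \<open>p\<close> justify
  summing the limits over \<open>m\<close>, which gives \<open>p'(T\<^sub>k(1))\<close>.
\<close>

lemma prot_limit:
  assumes c: "(\<lambda>n. pow32 n * fps_nth (tree_gf p) n) \<longlonglongrightarrow> c"
  shows "(\<lambda>n. pow32 n * fps_nth (prot_gf p k) n) \<longlonglongrightarrow> tail_limit k * c"
proof (induction k)
  case 0
  then show ?case using c by (simp add: tail_limit_def prot_gf_0)
next
  case (Suc k)
  obtain C where C: "0 \<le> C" "\<And>m n. pow32 n * fps_nth (tree_gf p ^ m) n \<le> C * real m"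
    using tree_power_bound by blast
  let ?a = "\<lambda>m n. fps_nth p (Suc m) * (pow32 n * fps_nth (prot_gf p k ^ Suc m) n)"
  let ?b = "\<lambda>m. fps_nth p (Suc m) * (real (Suc m) * prot_mass k ^ m * (tail_limit k * c))"
  have "(\<lambda>n. \<Sum>m. ?a m n) \<longlonglongrightarrow> suminf ?b"
  proof (rule tannery_uniform(2)[where N = 0])
    show "(\<lambda>n. ?a m n) \<longlonglongrightarrow> ?b m" for m
      using fps_power_limit[OF prot_gf_nonneg[OF nonneg] prot_summable Suc, of "Suc m"]
      by (intro tendsto_mult_left) (simp add: prot_mass_def)
    show "\<bar>?a m n\<bar> \<le> fps_nth p (Suc m) * (C * real (Suc m))" for m n
    proof -
      have "pow32 n * fps_nth (prot_gf p k ^ Suc m) n \<le> pow32 n * fps_nth (tree_gf p ^ Suc m) n"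
        by (intro mult_left_mono fps_nth_power_mono prot_gf_nonneg prot_gf_le_tree_gf nonneg pow32_nonneg)
      also have "\<dots> \<le> C * real (Suc m)" by (rule C(2))
      finally have "?a m n \<le> fps_nth p (Suc m) * (C * real (Suc m))"
        by (intro mult_left_mono nonneg)
      moreover have "0 \<le> ?a m n"
        by (intro mult_nonneg_nonneg nonneg pow32_nonneg fps_nth_power_nonneg prot_gf_nonneg)
      ultimately show ?thesis by linarith
    qed
    have "summable (\<lambda>m. C * (real (Suc m) * fps_nth p (Suc m)))"
      using mean_sums by (intro summable_mult) (subst summable_Suc_iff, simp add: sums_iff)
    then show "summable (\<lambda>m. fps_nth p (Suc m) * (C * real (Suc m)))"
      by (simp add: mult_ac)
  qed
  moreover have "(\<Sum>m. ?a m n) = pow32 n * fps_nth (prot_gf p (Suc k)) (Suc n)" for n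
    using sums_mult[OF prot_gf_Suc_nth_sums[of p k n], of "pow32 n"]
    by (simp add: sums_iff mult_ac)
  moreover have "suminf ?b = tail_limit (Suc k) * c"
  proof -
    have "(\<lambda>m. fps_nth (fps_deriv p) m * prot_mass k ^ m * (tail_limit k * c)) sums
        (eval_fps (fps_deriv p) (prot_mass k) * (tail_limit k * c))"
      by (intro sums_mult2 deriv_sums prot_mass_nonneg prot_mass_le_1)
    then show ?thesis by (simp add: sums_iff tail_limit_def mult_ac)
  qed
  ultimately have "(\<lambda>n. pow32 n * fps_nth (prot_gf p (Suc k)) (Suc n)) \<longlonglongrightarrow> tail_limit (Suc k) * c"
    by simp
  moreover have "(\<lambda>n. pow32 (Suc n) / pow32 n) \<longlonglongrightarrow> 1"
    using LIMSEQ_Suc[OF pow32_ratio_tendsto[of 1]] by simp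
  ultimately have "(\<lambda>n. pow32 (Suc n) / pow32 n * (pow32 n * fps_nth (prot_gf p (Suc k)) (Suc n))) \<longlonglongrightarrow> 1 * (tail_limit (Suc k) * c)"
    by (rule tendsto_mult[rotated])
  moreover have "\<forall>\<^sub>F n in sequentially. pow32 (Suc n) / pow32 n * (pow32 n * fps_nth (prot_gf p (Suc k)) (Suc n)) =
      pow32 (Suc n) * fps_nth (prot_gf p (Suc k)) (Suc n)"
    using eventually_gt_at_top[of 0]
  proof eventually_elim
    case (elim n)
    then show ?case using pow32_pos[of n] by simp
  qed
  ultimately have "(\<lambda>n. pow32 (Suc n) * fps_nth (prot_gf p (Suc k)) (Suc n)) \<longlonglongrightarrow> 1 * (tail_limit (Suc k) * c)"
    by (rule Lim_transform_eventually)
  then show ?case unfolding mult_1 by (rule LIMSEQ_imp_Suc)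
qed

text \<open>
  By \<open>fps_power_bound\<close>, a bound \<open>D\<close> for \<open>pow32 n * [z\<^sup>n] T\<^sub>k\<close> turns into
  \<open>D (p\<^sub>1 + 6 T\<^sub>k(1))\<close> at the next level once \<open>6 T\<^sub>k(1) < 1\<close>, up to the factor \<open>pow32 (n + 1) / pow32 n\<close> from the shift of
  the index. This factor exceeds 1 for every \<open>n\<close>, but is close to 1 for large \<open>n\<close>, and only \<open>n > k\<close>
  matter because a tree with protection number \<open>k\<close> has more than \<open>k\<close> nodes.
\<close>

lemma prot_geometric_bound:
  obtains r C where "0 < r" "r < 1" "\<And>k n. pow32 n * fps_nth (prot_gf p k) n \<le> C * r ^ k"
proof -
  obtain C where C: "0 \<le> C" "\<And>n. pow32 n * fps_nth (tree_gf p) n \<le> C"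
    using tree_power_bound by (metis mult.right_neutral of_nat_1 power_one_right)
  let ?p1 = "fps_nth p 1"
  have "?p1 + fps_nth p 0 \<le> 1"
    using sum_le_suminf[of "fps_nth p" "{0, 1}"] p_sums nonneg by (auto simp: sums_iff)
  then have p1: "0 \<le> ?p1" "?p1 < 1" using p0_pos nonneg by auto
  \<comment> \<open>The gap between \<open>s\<close> and \<open>r\<close> leaves room for the quotient of consecutive values of \<open>pow32\<close>.\<close>
  obtain r where r: "?p1 < r" "r < 1" using dense[OF p1(2)] by blast
  obtain s where s: "?p1 < s" "s < r" using dense[OF r(1)] by blast
  have "0 < s" using p1(1) s(1) by (rule order_le_less_trans)
  moreover have "0 < r" using p1(1) r(1) by (rule order_le_less_trans)
  ultimately have rs: "?p1 < s" "s < r" "0 < s" "0 < r" "r < 1" using r s by blast+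
  have "\<forall>\<^sub>F k in sequentially. ?p1 + 6 * prot_mass k < s \<and> 6 * prot_mass k < 1 \<and> pow32 (Suc k) / pow32 k < r / s \<and> 0 < k"
  proof (intro eventually_conj eventually_gt_at_top)
    have "(\<lambda>k. ?p1 + 6 * prot_mass k) \<longlonglongrightarrow> ?p1 + 6 * 0" by (intro tendsto_intros prot_mass_tendsto_0)
    then show "\<forall>\<^sub>F k in sequentially. ?p1 + 6 * prot_mass k < s" by (rule order_tendstoD(2)) (use rs in simp)
    have "(\<lambda>k. 6 * prot_mass k) \<longlonglongrightarrow> 6 * 0" by (intro tendsto_intros prot_mass_tendsto_0)
    then show "\<forall>\<^sub>F k in sequentially. 6 * prot_mass k < 1" by (rule order_tendstoD(2)) simp
    have "(\<lambda>n. pow32 (Suc n) / pow32 n) \<longlonglongrightarrow> 1" using LIMSEQ_Suc[OF pow32_ratio_tendsto[of 1]] by simp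
    then show "\<forall>\<^sub>F k in sequentially. pow32 (Suc k) / pow32 k < r / s"
      by (rule order_tendstoD(2)) (use rs in simp)
  qed
  then obtain K where K: "\<And>k. K \<le> k \<Longrightarrow>
      ?p1 + 6 * prot_mass k < s \<and> 6 * prot_mass k < 1 \<and> pow32 (Suc k) / pow32 k < r / s \<and> 0 < k"
    unfolding eventually_sequentially by blast
  have C': "pow32 n * fps_nth (prot_gf p k) n \<le> C" for k n
    by (rule order_trans[OF mult_left_mono[OF prot_gf_le_tree_gf[OF nonneg]] C(2)]) simp
  have tail: "pow32 n * fps_nth (prot_gf p (K + i)) n \<le> C * r ^ i" for i n
  proof (induction i arbitrary: n)
    case 0
    then show ?case using C' by simp
  next
    case (Suc i)
    let ?D = "C * r ^ i" and ?k = "K + i"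
    have D: "0 \<le> ?D" using C rs by simp
    show ?case
    proof (cases "n \<le> Suc ?k")
      case True
      then show ?thesis using C rs by (simp add: prot_gf_nth_eq_0)
    next
      case False
      then obtain n' where n': "n = Suc n'" "?k < n'" by (cases n) auto
      let ?x = "6 * prot_mass ?k"
      have x: "0 \<le> ?x" "?x < 1" "?p1 + ?x < s" using prot_mass_nonneg[of ?k] K[of ?k] by auto
      have "(\<lambda>m. pow32 n' * (fps_nth p (Suc m) * fps_nth (prot_gf p ?k ^ Suc m) n')) sums
          (pow32 n' * fps_nth (prot_gf p (Suc ?k)) n)"
        unfolding n' by (intro sums_mult prot_gf_Suc_nth_sums)
      moreover have "(\<lambda>m. ?D * (fps_nth p (Suc m) * ?x + (if m = 0 then ?p1 else 0))) sums
          (?D * ((1 - fps_nth p 0) * ?x + ?p1))"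
        using p_sums by (intro sums_mult sums_add sums_mult2 sums_single[of 0 "\<lambda>_. ?p1"])
          (subst sums_Suc_iff, simp)
      moreover have "pow32 n' * (fps_nth p (Suc m) * fps_nth (prot_gf p ?k ^ Suc m) n') \<le>
          ?D * (fps_nth p (Suc m) * ?x + (if m = 0 then ?p1 else 0))" for m
      proof -
        have "pow32 n' * fps_nth (prot_gf p ?k ^ Suc m) n' \<le> ?D * ?x ^ m"
          using fps_power_bound[OF prot_gf_nonneg[OF nonneg] prot_summable Suc, of n' m]
          by (simp only: prot_mass_def)
        also have "\<dots> \<le> ?D * (?x + (if m = 0 then 1 else 0))"
        proof (intro mult_left_mono D)
          have "y ^ m \<le> y + (if m = 0 then 1 else 0)" if "0 \<le> y" "y \<le> 1" for y :: real
            using that by (cases m) (auto simp: mult_left_le power_le_one)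
          then show "?x ^ m \<le> ?x + (if m = 0 then 1 else 0)"
            using x(1) less_imp_le[OF x(2)] by blast
        qed
        finally have "fps_nth p (Suc m) * (pow32 n' * fps_nth (prot_gf p ?k ^ Suc m) n') \<le>
            fps_nth p (Suc m) * (?D * (?x + (if m = 0 then 1 else 0)))"
          by (intro mult_left_mono nonneg)
        then show ?thesis by (cases "m = 0") (auto simp: algebra_simps)
      qed
      ultimately have "pow32 n' * fps_nth (prot_gf p (Suc ?k)) n \<le> ?D * ((1 - fps_nth p 0) * ?x + ?p1)"
        by (rule sums_le[rotated])
      also have "\<dots> \<le> ?D * s"
      proof (intro mult_left_mono D)
        have "(1 - fps_nth p 0) * ?x \<le> 1 * ?x"
          using p0_pos x(1) by (intro mult_right_mono) auto
        then show "(1 - fps_nth p 0) * ?x + ?p1 \<le> s" using x by linarith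
      qed
      finally have step: "pow32 n' * fps_nth (prot_gf p (Suc ?k)) n \<le> ?D * s" .
      have wn: "pow32 n \<le> r / s * pow32 n'" "0 < pow32 n'"
        using K[of n'] n' pow32_pos[of n'] by (auto simp: field_simps)
      have "pow32 n * fps_nth (prot_gf p (Suc ?k)) n \<le> r / s * pow32 n' * fps_nth (prot_gf p (Suc ?k)) n"
        by (intro mult_right_mono wn prot_gf_nonneg nonneg)
      also have "\<dots> = r / s * (pow32 n' * fps_nth (prot_gf p (Suc ?k)) n)" by simp
      also have "\<dots> \<le> r / s * (?D * s)"
        using rs by (intro mult_left_mono step) auto
      also have "\<dots> = C * r ^ Suc i" using rs by simp
      finally show ?thesis by simp
    qed
  qed
  show thesis
  proof (rule that[OF rs(4,5)])
    fix k n
    show "pow32 n * fps_nth (prot_gf p k) n \<le> C / r ^ K * r ^ k"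
    proof (cases "K \<le> k")
      case True
      then have "r ^ k = r ^ K * r ^ (k - K)" by (simp flip: power_add)
      then show ?thesis using tail[of n "k - K"] True rs by simp
    next
      case False
      have "C * r ^ K \<le> C * r ^ k"
        using False rs C by (intro mult_left_mono power_decreasing) auto
      then have "C \<le> C / r ^ K * r ^ k" using rs by (simp add: field_simps)
      then show ?thesis using C'[of n k] by linarith
    qed
  qed
qed

lemma tree_gf_eventually_pos: "\<forall>\<^sub>F n in sequentially. 0 < fps_nth (tree_gf p) n"
proof -
  obtain c where c: "0 < c" "(\<lambda>n. pow32 n * fps_nth (tree_gf p) n) \<longlonglongrightarrow> c"
    using tree_limit by blast
  have "\<forall>\<^sub>F n in sequentially. 0 < pow32 n * fps_nth (tree_gf p) n"
    by (rule order_tendstoD(1)[OF c(2,1)])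
  then show ?thesis
    by eventually_elim (use tree_gf_nonneg in \<open>auto simp: zero_less_mult_iff\<close>, metis pow32_nonneg not_le)
qed

lemma tree_gf_ratio: "(\<lambda>n. fps_nth (tree_gf p) n / fps_nth (tree_gf p) (Suc n)) \<longlonglongrightarrow> 1"
proof -
  obtain c where c: "0 < c" "(\<lambda>n. pow32 n * fps_nth (tree_gf p) n) \<longlonglongrightarrow> c"
    using tree_limit by blast
  have "(\<lambda>n. pow32 (Suc n) / pow32 n * ((pow32 n * fps_nth (tree_gf p) n) / (pow32 (Suc n) * fps_nth (tree_gf p) (Suc n)))) \<longlonglongrightarrow> 1 * (c / c)"
    using LIMSEQ_Suc[OF pow32_ratio_tendsto[of 1]] c
    by (intro tendsto_mult tendsto_divide c(2) LIMSEQ_Suc[OF c(2)]) auto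
  moreover have "\<forall>\<^sub>F n in sequentially.
      pow32 (Suc n) / pow32 n * ((pow32 n * fps_nth (tree_gf p) n) / (pow32 (Suc n) * fps_nth (tree_gf p) (Suc n))) =
      fps_nth (tree_gf p) n / fps_nth (tree_gf p) (Suc n)"
    using eventually_gt_at_top[of 0]
  proof eventually_elim
    case (elim n)
    then show ?case using pow32_pos[of n] pow32_pos[of "Suc n"] by simp
  qed
  ultimately have "(\<lambda>n. fps_nth (tree_gf p) n / fps_nth (tree_gf p) (Suc n)) \<longlonglongrightarrow> 1 * (c / c)"
    by (rule Lim_transform_eventually)
  then show ?thesis using c(1) by simp
qed

text \<open>
  A weighted sum of tail probabilities; \<open>prot_geometric_bound\<close> gives the dominating series. Taking \<open>g k = 1\<close> gives the mean,
  \<open>g k = 2 * k + 1\<close> the second moment.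
\<close>

theorem protection_tail_sum_limit:
  assumes g: "\<And>k. 0 \<le> g k" "\<And>r :: real. 0 < r \<Longrightarrow> r < 1 \<Longrightarrow> summable (\<lambda>k. g k * r ^ k)"
  shows "summable (\<lambda>k. g k * tail_limit (Suc k))"
    and "(\<lambda>n. \<Sum>k. g k * (fps_nth (prot_gf p (Suc k)) n / fps_nth (tree_gf p) n)) \<longlonglongrightarrow> (\<Sum>k. g k * tail_limit (Suc k))"
proof -
  obtain c where c: "0 < c" "(\<lambda>n. pow32 n * fps_nth (tree_gf p) n) \<longlonglongrightarrow> c"
    using tree_limit by blast
  obtain r C where r: "0 < r" "r < 1" "\<And>k n. pow32 n * fps_nth (prot_gf p k) n \<le> C * r ^ k"
    by (rule prot_geometric_bound) (rule that)
  have "\<forall>\<^sub>F n in sequentially. c / 2 < pow32 n * fps_nth (tree_gf p) n"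
    by (rule order_tendstoD(1)[OF c(2)]) (use c in simp)
  then obtain N where N: "\<And>n. N \<le> n \<Longrightarrow> c / 2 < pow32 n * fps_nth (tree_gf p) n"
    unfolding eventually_sequentially by blast
  have N0: "0 < pow32 n" "0 < fps_nth (tree_gf p) n" if "N \<le> n" for n
  proof -
    have "0 < pow32 n * fps_nth (tree_gf p) n" using N[OF that] c by linarith
    then show "0 < pow32 n" "0 < fps_nth (tree_gf p) n"
      using pow32_nonneg[of n] tree_gf_nonneg[of n] by (auto simp: zero_less_mult_iff)
  qed
  let ?a = "\<lambda>k n. g k * (fps_nth (prot_gf p (Suc k)) n / fps_nth (tree_gf p) n)"
  have lim: "(\<lambda>n. ?a k n) \<longlonglongrightarrow> g k * tail_limit (Suc k)" for k
  proof (intro tendsto_mult_left)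
    have "(\<lambda>n. (pow32 n * fps_nth (prot_gf p (Suc k)) n) / (pow32 n * fps_nth (tree_gf p) n)) \<longlonglongrightarrow> tail_limit (Suc k) * c / c"
      using c by (intro tendsto_divide prot_limit c(2)) auto
    moreover have "\<forall>\<^sub>F n in sequentially. (pow32 n * fps_nth (prot_gf p (Suc k)) n) / (pow32 n * fps_nth (tree_gf p) n) =
        fps_nth (prot_gf p (Suc k)) n / fps_nth (tree_gf p) n"
      using eventually_ge_at_top[of N]
    proof eventually_elim
      case (elim n)
      then show ?case using N0(1)[of n] by simp
    qed
    ultimately have "(\<lambda>n. fps_nth (prot_gf p (Suc k)) n / fps_nth (tree_gf p) n) \<longlonglongrightarrow> tail_limit (Suc k) * c / c"
      by (rule Lim_transform_eventually)
    then show "(\<lambda>n. fps_nth (prot_gf p (Suc k)) n / fps_nth (tree_gf p) n) \<longlonglongrightarrow> tail_limit (Suc k)"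
      using c(1) by simp
  qed
  have bound: "\<bar>?a k n\<bar> \<le> g k * r ^ k * (2 * C * r / c)" if n: "N \<le> n" for k n
  proof -
    let ?y = "fps_nth (prot_gf p (Suc k)) n" and ?t = "fps_nth (tree_gf p) n"
    have y: "0 \<le> ?y" by (rule prot_gf_nonneg[OF nonneg])
    have "0 \<le> C * r ^ Suc k" by (rule order_trans[OF _ r(3)[of n "Suc k"]]) (simp add: y)
    have "?y / ?t = (pow32 n * ?y) / (pow32 n * ?t)" using N0[OF n] by simp
    also have "\<dots> \<le> (C * r ^ Suc k) / (c / 2)"
      using r(3)[of n "Suc k"] N[OF n] c y \<open>0 \<le> C * r ^ Suc k\<close> by (intro frac_le) auto
    finally have "g k * (?y / ?t) \<le> g k * ((C * r ^ Suc k) / (c / 2))"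
      by (intro mult_left_mono g)
    moreover have "0 \<le> g k * (?y / ?t)" using g y N0[OF n] by simp
    moreover have "g k * ((C * r ^ Suc k) / (c / 2)) = g k * r ^ k * (2 * C * r / c)"
      by simp
    ultimately show ?thesis by linarith
  qed
  have s: "summable (\<lambda>k. g k * r ^ k * (2 * C * r / c))" using g(2)[OF r(1,2)] by (rule summable_mult2)
  show "summable (\<lambda>k. g k * tail_limit (Suc k))" "(\<lambda>n. \<Sum>k. ?a k n) \<longlonglongrightarrow> (\<Sum>k. g k * tail_limit (Suc k))"
    using tannery_uniform[OF lim bound s] by auto
qed

lemma tail_limit_Suc: "tail_limit (Suc k) = (\<Prod>i=1..k. eval_fps (fps_deriv p) (prot_mass i))"
proof -
  have "tail_limit (Suc k) = (\<Prod>i<k. eval_fps (fps_deriv p) (prot_mass (Suc i)))"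
    by (simp only: tail_limit_def prod.lessThan_Suc_shift prot_mass_0 mean mult_1)
  also have "\<dots> = (\<Prod>i=1..k. eval_fps (fps_deriv p) (prot_mass i))"
    by (rule prod.reindex_bij_witness[of _ "\<lambda>i. i - 1" Suc]) auto
  finally show ?thesis .
qed

end

section \<open>The protection number of a random simply generated tree\<close>

text \<open>
  Summation by layers: \<open>g k\<close> is counted once for every tree of protection number larger than \<open>k\<close>.
\<close>

lemma expectation_protection_tails:
  fixes g :: "nat \<Rightarrow> real"
  assumes nonneg: "\<And>j. fps_nth \<phi> j \<ge> 0" and pos: "fps_nth (tree_gf \<phi>) n > 0"
  shows "measure_pmf.expectation (random_tree \<phi> n) (\<lambda>t. \<Sum>k<protection t. g k) =
    (\<Sum>k. g k * (fps_nth (prot_gf \<phi> (Suc k)) n / fps_nth (tree_gf \<phi>) n))"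
proof -
  let ?S = "{t. nodes t = n}"
  note fin = finite_nodes_eq[of n]
  note pmf = pmf_random_tree[OF nonneg pos]
  have "measure_pmf.expectation (random_tree \<phi> n) (\<lambda>t. \<Sum>k<protection t. g k) =
      (\<Sum>t\<in>?S. (\<Sum>k<protection t. g k) * pmf (random_tree \<phi> n) t)"
    using pmf by (intro integral_measure_pmf_real fin) (auto simp: set_pmf_iff split: if_splits)
  also have "\<dots> = (\<Sum>t\<in>?S. \<Sum>k<n. if k < protection t then g k * (weight \<phi> t / fps_nth (tree_gf \<phi>) n) else 0)"
  proof (intro sum.cong refl)
    fix t assume t: "t \<in> ?S"
    then have "{..<protection t} = {k \<in> {..<n}. k < protection t}"
      using protection_less_nodes[of t] by auto
    moreover have "pmf (random_tree \<phi> n) t = weight \<phi> t / fps_nth (tree_gf \<phi>) n"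
      using t pmf by simp
    ultimately have "(\<Sum>k<protection t. g k) * pmf (random_tree \<phi> n) t =
        (\<Sum>k\<in>{k \<in> {..<n}. k < protection t}. g k * (weight \<phi> t / fps_nth (tree_gf \<phi>) n))"
      by (simp only: sum_distrib_right)
    also have "\<dots> = (\<Sum>k<n. if k < protection t then g k * (weight \<phi> t / fps_nth (tree_gf \<phi>) n) else 0)"
      by (rule sum.inter_filter) simp
    finally show "(\<Sum>k<protection t. g k) * pmf (random_tree \<phi> n) t =
        (\<Sum>k<n. if k < protection t then g k * (weight \<phi> t / fps_nth (tree_gf \<phi>) n) else 0)" .
  qed
  also have "\<dots> = (\<Sum>k<n. \<Sum>t\<in>?S. if k < protection t then g k * (weight \<phi> t / fps_nth (tree_gf \<phi>) n) else 0)"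
    by (rule sum.swap)
  also have "\<dots> = (\<Sum>k<n. g k * (fps_nth (prot_gf \<phi> (Suc k)) n / fps_nth (tree_gf \<phi>) n))"
  proof (intro sum.cong refl)
    fix k
    have "(\<Sum>t\<in>?S. if k < protection t then g k * (weight \<phi> t / fps_nth (tree_gf \<phi>) n) else 0) =
        (\<Sum>t\<in>{t\<in>?S. k < protection t}. g k * (weight \<phi> t / fps_nth (tree_gf \<phi>) n))"
      by (rule sum.inter_filter[OF fin, symmetric])
    also have "\<dots> = g k * (fps_nth (prot_gf \<phi> (Suc k)) n / fps_nth (tree_gf \<phi>) n)"
      by (simp add: prot_gf_def sum_distrib_left sum_divide_distrib Suc_le_eq)
    finally show "(\<Sum>t\<in>?S. if k < protection t then g k * (weight \<phi> t / fps_nth (tree_gf \<phi>) n) else 0) =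
        g k * (fps_nth (prot_gf \<phi> (Suc k)) n / fps_nth (tree_gf \<phi>) n)" .
  qed
  also have "\<dots> = (\<Sum>k. g k * (fps_nth (prot_gf \<phi> (Suc k)) n / fps_nth (tree_gf \<phi>) n))"
    by (rule suminf_finite[symmetric]) (auto simp: prot_gf_nth_eq_0 not_less)
  finally show ?thesis .
qed

lemma variance_random_tree:
  fixes X :: "ptree \<Rightarrow> real"
  assumes nonneg: "\<And>j. fps_nth \<phi> j \<ge> 0" and pos: "fps_nth (tree_gf \<phi>) n > 0"
  shows "measure_pmf.variance (random_tree \<phi> n) X =
    measure_pmf.expectation (random_tree \<phi> n) (\<lambda>t. (X t)\<^sup>2) - (measure_pmf.expectation (random_tree \<phi> n) X)\<^sup>2"
proof -
  have "set_pmf (random_tree \<phi> n) \<subseteq> {t. nodes t = n}"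
    using pmf_random_tree[OF nonneg pos] by (auto simp: set_pmf_iff split: if_splits)
  then have "finite (set_pmf (random_tree \<phi> n))"
    by (rule finite_subset[OF _ finite_nodes_eq])
  then show ?thesis
    by (intro measure_pmf.variance_eq integrable_measure_pmf_finite)
qed

lemma sum_odd_eq_square: "(\<Sum>k<j. 2 * real k + 1) = (real j)\<^sup>2"
  by (induction j) (auto simp: power2_eq_square algebra_simps)

lemma has_sum_from_1:
  fixes a :: "nat \<Rightarrow> real"
  assumes "summable (\<lambda>k. a (Suc k))" "\<And>k. 0 \<le> a (Suc k)"
  shows "(a has_sum (\<Sum>k. a (Suc k))) {1..}"
proof -
  have "((\<lambda>k. a (Suc k)) has_sum (\<Sum>k. a (Suc k))) UNIV"
    by (intro sums_nonneg_imp_has_sum summable_sums assms)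
  moreover have "range Suc = {1..}"
    by (auto simp: image_def Suc_le_eq gr0_conv_Suc)
  ultimately show ?thesis
    using has_sum_reindex[of Suc UNIV a "\<Sum>k. a (Suc k)"] by (simp add: o_def)
qed

text \<open>
  The exponential change of measure that turns a weight series into a probability distribution;
  its mean is 1 exactly when \<open>\<tau> \<phi>'(\<tau>) = \<phi>(\<tau>)\<close>.
\<close>

definition tilt :: "real fps \<Rightarrow> real \<Rightarrow> real fps" where
  "tilt \<phi> \<tau> = Abs_fps (\<lambda>j. fps_nth \<phi> j * \<tau> ^ j / eval_fps \<phi> \<tau>)"

lemma tilt_nth: "fps_nth (tilt \<phi> \<tau>) j = fps_nth \<phi> j * \<tau> ^ j / eval_fps \<phi> \<tau>"
  by (simp add: tilt_def)

text \<open>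
  A tree with \<open>n\<close> nodes has \<open>n - 1\<close> edges, so the powers of \<open>\<tau>\<close> at its nodes multiply to \<open>\<tau>\<^sup>n\<^sup>-\<^sup>1\<close>.
\<close>

lemma weight_tilt:
  assumes \<tau>: "0 < \<tau>" and F: "0 < eval_fps \<phi> \<tau>"
  shows "weight (tilt \<phi> \<tau>) t = weight \<phi> t * (\<tau> / eval_fps \<phi> \<tau>) ^ nodes t / \<tau>"
proof (induction t)
  case (Node ts)
  let ?\<rho> = "\<tau> / eval_fps \<phi> \<tau>"
  have "prod_list (map (weight (tilt \<phi> \<tau>)) ts) =
      prod_list (map (weight \<phi>) ts) * ?\<rho> ^ sum_list (map nodes ts) / \<tau> ^ length ts"
    using Node by (induction ts) (auto simp: power_add)
  then show ?case
    using \<tau> F by (simp add: tilt_nth field_simps)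
qed

lemma prot_gf_tilt:
  assumes "0 < \<tau>" "0 < eval_fps \<phi> \<tau>"
  shows "fps_nth (prot_gf (tilt \<phi> \<tau>) k) n = fps_nth (prot_gf \<phi> k) n * (\<tau> / eval_fps \<phi> \<tau>) ^ n / \<tau>"
  unfolding prot_gf_def fps_nth_Abs_fps sum_distrib_right sum_divide_distrib
  by (intro sum.cong refl) (auto simp: weight_tilt[OF assms])

lemma eval_fps_deriv_tilt:
  assumes \<tau>: "0 < \<tau>" "ereal \<tau> < fps_conv_radius \<phi>" and x: "0 \<le> x" "x \<le> 1"
  shows "eval_fps (fps_deriv (tilt \<phi> \<tau>)) x = \<tau> / eval_fps \<phi> \<tau> * eval_fps (fps_deriv \<phi>) (\<tau> * x)"
proof -
  have "ereal (norm (\<tau> * x)) \<le> ereal \<tau>" using \<tau> x by (simp add: abs_mult mult_left_le)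
  also have "\<dots> < fps_conv_radius (fps_deriv \<phi>)"
    using \<tau>(2) fps_conv_radius_deriv by (rule order_less_le_trans)
  finally have "summable (\<lambda>n. fps_nth (fps_deriv \<phi>) n * (\<tau> * x) ^ n)"
    by (rule summable_fps)
  then have "(\<Sum>n. \<tau> / eval_fps \<phi> \<tau> * (fps_nth (fps_deriv \<phi>) n * (\<tau> * x) ^ n)) =
      \<tau> / eval_fps \<phi> \<tau> * eval_fps (fps_deriv \<phi>) (\<tau> * x)"
    unfolding eval_fps_def by (rule suminf_mult)
  then show ?thesis
    by (simp add: eval_fps_def[of "fps_deriv (tilt \<phi> \<tau>)"] tilt_nth power_mult_distrib mult_ac)
qed

lemma critical_offspring_tilt:
  assumes nonneg: "\<And>j. fps_nth \<phi> j \<ge> 0" and \<phi>0: "fps_nth \<phi> 0 > 0"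
    and branching: "\<exists>j\<ge>2. fps_nth \<phi> j > 0"
    and \<tau>: "0 < \<tau>" "ereal \<tau> < fps_conv_radius \<phi>"
    and crit: "\<tau> * eval_fps (fps_deriv \<phi>) \<tau> = eval_fps \<phi> \<tau>"
    and np: "nonperiodic \<phi>"
  shows "0 < eval_fps \<phi> \<tau>" and "critical_offspring (tilt \<phi> \<tau>)"
proof -
  have F_sums: "(\<lambda>j. fps_nth \<phi> j * \<tau> ^ j) sums eval_fps \<phi> \<tau>"
    using \<tau> by (intro sums_eval_fps) auto
  have "fps_nth \<phi> 0 * \<tau> ^ 0 \<le> eval_fps \<phi> \<tau>"
    by (rule term_le_of_sums_nonneg[OF F_sums]) (use nonneg \<tau> in auto)
  then show F: "0 < eval_fps \<phi> \<tau>" using \<phi>0 by simp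
  have pos_iff: "0 < fps_nth (tilt \<phi> \<tau>) j \<longleftrightarrow> 0 < fps_nth \<phi> j" for j
    using \<tau> F by (simp add: tilt_nth zero_less_divide_iff zero_less_mult_iff)
  show "critical_offspring (tilt \<phi> \<tau>)"
  proof
    show "0 \<le> fps_nth (tilt \<phi> \<tau>) j" for j
      using nonneg \<tau> F by (simp add: tilt_nth)
    show "0 < fps_nth (tilt \<phi> \<tau>) 0" "\<exists>j\<ge>2. 0 < fps_nth (tilt \<phi> \<tau>) j" "nonperiodic (tilt \<phi> \<tau>)"
      using \<phi>0 branching np by (simp_all add: pos_iff nonperiodic_def)
    obtain s where s: "ereal \<tau> < ereal s" "ereal s < fps_conv_radius \<phi>"
      using ereal_dense2[OF \<tau>(2)] by blast
    have "summable (\<lambda>j. fps_nth \<phi> j * s ^ j)"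
      using s \<tau> by (intro summable_fps) auto
    then have "summable (\<lambda>j. fps_nth \<phi> j * s ^ j / eval_fps \<phi> \<tau>)"
      by (rule summable_divide)
    moreover have "(\<lambda>j. fps_nth \<phi> j * s ^ j / eval_fps \<phi> \<tau>) = (\<lambda>j. fps_nth (tilt \<phi> \<tau>) j * (s / \<tau>) ^ j)"
      using \<tau> by (auto simp: tilt_nth power_divide)
    ultimately have "conv_radius (fps_nth (tilt \<phi> \<tau>)) \<ge> norm (s / \<tau>)"
      by (intro conv_radius_geI) simp
    moreover have "1 < ereal (norm (s / \<tau>))"
      using s \<tau> by (simp add: one_ereal_def)
    ultimately show "1 < fps_conv_radius (tilt \<phi> \<tau>)"
      unfolding fps_conv_radius_def by (rule order_less_le_trans[rotated])
    have "(\<lambda>j. fps_nth \<phi> j * \<tau> ^ j / eval_fps \<phi> \<tau>) sums (eval_fps \<phi> \<tau> / eval_fps \<phi> \<tau>)"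
      by (rule sums_divide[OF F_sums])
    then show "eval_fps (tilt \<phi> \<tau>) 1 = 1"
      using F by (simp add: eval_fps_def[of "tilt \<phi> \<tau>"] tilt_nth sums_iff)
    show "eval_fps (fps_deriv (tilt \<phi> \<tau>)) 1 = 1"
      using eval_fps_deriv_tilt[OF \<tau>, of 1] crit F by simp
  qed
qed

text \<open>
  Consecutive coefficients of the tilted generating function have ratio tending to 1, and tilting
  multiplies the \<open>n\<close>-th coefficient by \<open>\<rho>\<^sup>n / \<tau>\<close>.
\<close>

lemma dominant_singularity_eq:
  assumes \<tau>: "0 < \<tau>" and F: "0 < eval_fps \<phi> \<tau>" and crit: "critical_offspring (tilt \<phi> \<tau>)"
  shows "dominant_singularity \<phi> = \<tau> / eval_fps \<phi> \<tau>"
proof -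
  interpret critical_offspring "tilt \<phi> \<tau>" by (rule crit)
  define \<rho> where "\<rho> = \<tau> / eval_fps \<phi> \<tau>"
  have \<rho>: "0 < \<rho>" using \<tau> F by (simp add: \<rho>_def)
  have t: "fps_nth (tree_gf (tilt \<phi> \<tau>)) n = fps_nth (tree_gf \<phi>) n * \<rho> ^ n / \<tau>" for n
    using prot_gf_tilt[OF \<tau> F, of 0 n] by (simp add: prot_gf_0 \<rho>_def)
  have "(\<lambda>n. \<rho> * norm (fps_nth (tree_gf (tilt \<phi> \<tau>)) n / fps_nth (tree_gf (tilt \<phi> \<tau>)) (Suc n))) \<longlonglongrightarrow> \<rho> * norm (1::real)"
    by (intro tendsto_mult_left tendsto_norm tree_gf_ratio)
  then have "(\<lambda>n. norm (fps_nth (tree_gf \<phi>) n) / norm (fps_nth (tree_gf \<phi>) (Suc n))) \<longlonglongrightarrow> \<rho>"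
    using \<tau> \<rho> by (simp add: t abs_mult field_simps)
  then have "fps_conv_radius (tree_gf \<phi>) = ereal \<rho>"
    unfolding fps_conv_radius_def using \<rho> by (intro conv_radius_ratio_limit_nonzero) auto
  then show ?thesis by (simp add: dominant_singularity_def \<rho>_def)
qed

theorem theorem1:
  fixes \<phi> :: "real fps" and \<rho> :: real and T :: "nat \<Rightarrow> real fps"
  defines "\<rho> \<equiv> dominant_singularity \<phi>"
  defines "T \<equiv> prot_gf \<phi>"
  assumes "\<And>j. fps_nth \<phi> j \<ge> 0"
    and "fps_nth \<phi> 0 > 0"
    and "\<exists>j\<ge>2. fps_nth \<phi> j > 0"
    and "\<exists>!\<tau>::real. 0 < \<tau> \<and> ereal \<tau> < fps_conv_radius \<phi> \<and>
           \<tau> * eval_fps (fps_deriv \<phi>) \<tau> = eval_fps \<phi> \<tau>"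
    and "nonperiodic \<phi>"
  shows
    "(\<lambda>k. \<rho> ^ (k - 1) * (\<Prod>i=1..k - 1. eval_fps (fps_deriv \<phi>) (eval_fps (T i) \<rho>)))
       summable_on {1..} \<and>
    (\<lambda>n. measure_pmf.expectation (random_tree \<phi> n) (\<lambda>t. real (protection t)))
       \<longlonglongrightarrow> (\<Sum>\<^sub>\<infinity>k\<in>{1..}. \<rho> ^ (k - 1) *
             (\<Prod>i=1..k - 1. eval_fps (fps_deriv \<phi>) (eval_fps (T i) \<rho>))) \<and>
    (\<lambda>k. (2 * real k - 1) * \<rho> ^ (k - 1) *
         (\<Prod>i=1..k - 1. eval_fps (fps_deriv \<phi>) (eval_fps (T i) \<rho>)))
       summable_on {1..} \<and>
    (\<lambda>n. measure_pmf.variance (random_tree \<phi> n) (\<lambda>t. real (protection t)))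
       \<longlonglongrightarrow> (\<Sum>\<^sub>\<infinity>k\<in>{1..}. (2 * real k - 1) * \<rho> ^ (k - 1) *
             (\<Prod>i=1..k - 1. eval_fps (fps_deriv \<phi>) (eval_fps (T i) \<rho>)))
         - (lim (\<lambda>n. measure_pmf.expectation (random_tree \<phi> n) (\<lambda>t. real (protection t))))\<^sup>2"
proof -
  obtain \<tau> where \<tau>: "0 < \<tau>" "ereal \<tau> < fps_conv_radius \<phi>"
      "\<tau> * eval_fps (fps_deriv \<phi>) \<tau> = eval_fps \<phi> \<tau>"
    using assms(6) by blast
  note F = critical_offspring_tilt(1)[OF assms(3-5) \<tau> assms(7)]
  note crit = critical_offspring_tilt(2)[OF assms(3-5) \<tau> assms(7)]
  interpret critical_offspring "tilt \<phi> \<tau>" by (rule crit)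
  have \<rho>: "\<rho> = \<tau> / eval_fps \<phi> \<tau>"
    unfolding \<rho>_def by (rule dominant_singularity_eq[OF \<tau>(1) F crit])
  have \<rho>_pos: "0 < \<rho>" using \<tau> F by (simp add: \<rho>)
  have gf: "fps_nth (prot_gf (tilt \<phi> \<tau>) k) n = fps_nth (prot_gf \<phi> k) n * \<rho> ^ n / \<tau>" for k n
    unfolding \<rho> by (rule prot_gf_tilt[OF \<tau>(1) F])
  have gf0: "fps_nth (tree_gf (tilt \<phi> \<tau>)) n = fps_nth (tree_gf \<phi>) n * \<rho> ^ n / \<tau>" for n
    using gf[of 0 n] by (simp add: prot_gf_0)
  have T_eq: "eval_fps (T i) \<rho> = \<tau> * prot_mass i" for i
  proof -
    have "(\<Sum>n. \<tau> * fps_nth (prot_gf (tilt \<phi> \<tau>) i) n) = \<tau> * prot_mass i"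
      unfolding prot_mass_def by (rule suminf_mult[OF prot_summable])
    then show ?thesis using \<tau> by (simp add: eval_fps_def T_def gf)
  qed
  define e where "e k = \<rho> ^ (k - 1) * (\<Prod>i=1..k - 1. eval_fps (fps_deriv \<phi>) (eval_fps (T i) \<rho>))" for k
  have e_Suc: "e (Suc k) = tail_limit (Suc k)" for k
  proof -
    have "tail_limit (Suc k) = (\<Prod>i=1..k. \<rho> * eval_fps (fps_deriv \<phi>) (eval_fps (T i) \<rho>))"
      unfolding tail_limit_Suc T_eq unfolding \<rho>
      by (intro prod.cong refl eval_fps_deriv_tilt[OF \<tau>(1,2)] prot_mass_nonneg prot_mass_le_1)
    then show ?thesis by (simp add: e_def prod.distrib)
  qed
  have ratio: "fps_nth (prot_gf (tilt \<phi> \<tau>) k) n / fps_nth (tree_gf (tilt \<phi> \<tau>)) n =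
      fps_nth (prot_gf \<phi> k) n / fps_nth (tree_gf \<phi>) n" for k n
    using \<tau> \<rho>_pos by (simp add: gf gf0)
  have ev_pos: "\<forall>\<^sub>F n in sequentially. 0 < fps_nth (tree_gf \<phi>) n"
    using tree_gf_eventually_pos
    by eventually_elim (use \<tau> \<rho>_pos in \<open>auto simp: gf0 zero_less_mult_iff zero_less_divide_iff\<close>)
  have lim: "(\<lambda>n. measure_pmf.expectation (random_tree \<phi> n) (\<lambda>t. \<Sum>k<protection t. g k)) \<longlonglongrightarrow>
      (\<Sum>k. g k * e (Suc k))" and summ: "summable (\<lambda>k. g k * e (Suc k))"
    if g: "\<And>k. 0 \<le> g k" "\<And>r :: real. 0 < r \<Longrightarrow> r < 1 \<Longrightarrow> summable (\<lambda>k. g k * r ^ k)" for g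
  proof -
    show "summable (\<lambda>k. g k * e (Suc k))"
      unfolding e_Suc using g by (rule protection_tail_sum_limit(1))
    have "\<forall>\<^sub>F n in sequentially. (\<Sum>k. g k * (fps_nth (prot_gf (tilt \<phi> \<tau>) (Suc k)) n / fps_nth (tree_gf (tilt \<phi> \<tau>)) n)) =
        measure_pmf.expectation (random_tree \<phi> n) (\<lambda>t. \<Sum>k<protection t. g k)"
      using ev_pos by eventually_elim (simp only: expectation_protection_tails[OF assms(3)] ratio)
    with protection_tail_sum_limit(2)[OF g]
    show "(\<lambda>n. measure_pmf.expectation (random_tree \<phi> n) (\<lambda>t. \<Sum>k<protection t. g k)) \<longlonglongrightarrow>
        (\<Sum>k. g k * e (Suc k))"
      unfolding e_Suc by (rule Lim_transform_eventually)
  qed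
  have e_nonneg: "0 \<le> e (Suc k)" for k
    unfolding e_Suc tail_limit_def
    by (intro prod_nonneg ballI) (use prot_mass_nonneg prot_mass_le_1 in \<open>auto intro: deriv_nonneg\<close>)
  have s1: "summable (\<lambda>k. 1 * r ^ k)" if "0 < r" "r < 1" for r :: real
    using that by (simp add: summable_geometric)
  have s2: "summable (\<lambda>k. (2 * real k + 1) * r ^ k)" if "0 < r" "r < 1" for r :: real
  proof -
    have "summable (\<lambda>k. real (Suc k) * r ^ k)"
      using that by (intro sums_summable[OF geometric_deriv_sums]) auto
    then have "summable (\<lambda>k. 2 * (real (Suc k) * r ^ k) - 1 * r ^ k)"
      by (intro summable_diff summable_mult s1 that)
    then show ?thesis by (simp add: algebra_simps)
  qed
  let ?E = "\<lambda>n. measure_pmf.expectation (random_tree \<phi> n) (\<lambda>t. real (protection t))"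
  have E: "?E \<longlonglongrightarrow> (\<Sum>k. e (Suc k))"
    using lim[of "\<lambda>_. 1", OF _ s1] by simp
  have E2: "(\<lambda>n. measure_pmf.expectation (random_tree \<phi> n) (\<lambda>t. (real (protection t))\<^sup>2)) \<longlonglongrightarrow>
      (\<Sum>k. (2 * real k + 1) * e (Suc k))"
    using lim[of "\<lambda>k. 2 * real k + 1", OF _ s2] unfolding sum_odd_eq_square by simp
  have "(\<lambda>n. measure_pmf.expectation (random_tree \<phi> n) (\<lambda>t. (real (protection t))\<^sup>2) - (?E n)\<^sup>2) \<longlonglongrightarrow>
      (\<Sum>k. (2 * real k + 1) * e (Suc k)) - (\<Sum>k. e (Suc k))\<^sup>2"
    by (intro tendsto_intros E E2)
  moreover have "\<forall>\<^sub>F n in sequentially.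
      measure_pmf.expectation (random_tree \<phi> n) (\<lambda>t. (real (protection t))\<^sup>2) - (?E n)\<^sup>2 =
      measure_pmf.variance (random_tree \<phi> n) (\<lambda>t. real (protection t))"
    using ev_pos by eventually_elim (simp add: variance_random_tree[OF assms(3)])
  ultimately have V: "(\<lambda>n. measure_pmf.variance (random_tree \<phi> n) (\<lambda>t. real (protection t))) \<longlonglongrightarrow>
      (\<Sum>k. (2 * real k + 1) * e (Suc k)) - (\<Sum>k. e (Suc k))\<^sup>2"
    by (rule Lim_transform_eventually)
  have h1: "(e has_sum (\<Sum>k. e (Suc k))) {1..}"
    using summ[of "\<lambda>_. 1", OF _ s1] e_nonneg by (intro has_sum_from_1) auto
  have h2: "((\<lambda>k. (2 * real k - 1) * e k) has_sum (\<Sum>k. (2 * real k + 1) * e (Suc k))) {1..}"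
    using has_sum_from_1[of "\<lambda>k. (2 * real k - 1) * e k"] summ[of "\<lambda>k. 2 * real k + 1", OF _ s2] e_nonneg
    by (simp add: algebra_simps)
  show ?thesis
    unfolding mult.assoc[of "2 * real _ - 1"] e_def[symmetric]
    using h1 h2 E V limI[OF E]
    by (simp add: infsumI has_sum_imp_summable)
qed

end
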